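(* Let $k=k_n$ and $m=m_n$ be integer sequences with $n>2k_n$, $0\le m_n\le\lfloor(n-2k_n)/2\rfloor$, $\lim_{n\to\infty}k_n=\infty$, and such that for every $\epsilon>0$ $$\sum_n 2(k_n+1)\exp\Bigg(-(n-2k_n)\Big[\frac{\epsilon^2}{2(k_n+1)L_{\max}^2}-2|\mathcal Z|^{2k_n}\Big\{h\Big(\frac{m_n}{n-2k_n}\Big)+\frac{(m_n+1)\ln N}{n-2k_n}\Big\}\Big]\Bigg)<\infty,$$ with $h(x)=-x\ln x-(1-x)\ln(1-x)$ and $N=|\mathcal S|$. Let $\hat{\mathbf X}^n$ be the $(k_n,m_n)$-S-DUDE. Then for every process distribution $P_{\mathbf X}\in\mathcal P\{m_n\}$, $$\lim_{n\to\infty}\Big[E\,L_{\hat{\mathbf X}^n}(X^n,Z^n)-\mathbb D(P_{X^n},\Pi)\Big]=0,$$ where $X^n$ is drawn from $P_{X^n}$ and $Z^n$ is the output of the channel $\Pi$ with input $X^n$.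
   Context: Let $\mathcal X,\mathcal Z,\hat{\mathcal X}$ be finite alphabets and $\Pi=\{\Pi(x,z)\}$ a $|\mathcal X|\times|\mathcal Z|$ stochastic matrix (discrete memoryless channel) of full row rank; given input $X^n$, the outputs $Z_t$ are conditionally independent with $\Pr(Z_t=z\mid X^n)=\Pi(X_t,z)$. Fix a loss $\Lambda:\mathcal X\times\hat{\mathcal X}\to[0,\infty)$, $\Lambda_{\max}=\max\Lambda$. Let $\mathcal S$ be the set of maps $\mathcal Z\to\hat{\mathcal X}$; fix a real $|\mathcal Z|\times|\mathcal X|$ matrix $H$ with $\Pi H=I$ and let $h(z)$ be the column vector equal to its $z$-th row; $\rho_x(s)=\sum_z\Lambda(x,s(z))\Pi(x,z)$; $\ell(z,s)=h(z)^T\rho(s)$; $\ell_{\max}=\max_{z,s}\ell-\min_{z,s}\ell$; $L_{\max}=\Lambda_{\max}+\ell_{\max}$. An $n$-block denoiser is $\hat{\mathbf X}^n=(\hat X_t)_{t=1}^n$, $\hat X_t:\mathcal Z^n\to\hat{\mathcal X}$, with $L_{\hat{\mathbf X}^n}(x^n,z^n)=\frac1n\sum_t\Lambda(x_t,\hat X_t(z^n))$; $\mathbb D(P_{X^n},\Pi)=\min_{\hat{\mathbf X}^n}E\,L_{\hat{\mathbf X}^n}(X^n,Z^n)$, the minimum over all $n$-block denoisers. S-DUDE: for $z^n$ and $k+1\le t\le n-k$, $\mathbf c_t=(z_{t-k}^{t-1},z_{t+1}^{t+k})$, $\mathcal T(\mathbf c)=\{t:k+1\le t\le n-k,\mathbf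 c_t=\mathbf c\}$; $\mathcal S^n_{k,m}(z^n)$ is the set of $(\sigma_{k+1},\dots,\sigma_{n-k})\in\mathcal S^{n-2k}$ such that for every $\mathbf c\in\mathcal Z^{2k}$, writing $\mathcal T(\mathbf c)=\{\tau_1<\dots<\tau_r\}$, at most $m$ indices $j<r$ have $\sigma_{\tau_j}\ne\sigma_{\tau_{j+1}}$. The $(k,m)$-S-DUDE outputs $\hat X_t(z^n)=\hat\sigma_t(z_t)$ for $k+1\le t\le n-k$, where $(\hat\sigma_t)$ minimizes $\frac1{n-2k}\sum_{t=k+1}^{n-k}\ell(z_t,\sigma_t)$ over $\mathcal S^n_{k,m}(z^n)$, and a fixed arbitrary symbol for other $t$. Class $\mathcal P\{m_n\}$: a distribution $P_{\mathbf X}$ on $\mathcal X^\infty$ belongs to it if there exist $M\ge1$, distributions $P^{(1)},\dots,P^{(M)}$ of stationary processes with values in $\mathcal X$, and a process $\mathbf A$ with values in $\{1,\dots,M\}$ such that $r(A^n)=\sum_{j=1}^{n-1}\mathbf 1_{\{A_j\ne A_{j+1}\}}\le m_n$ a.s. for all $n$, and for all $n$, $P_{X^n}(x^n)=\sum_{a^n}P_{A^n}(a^n)\prod_{i=1}^{r+1}P^{(a_{\tau_i})}(x_{\tau_{i-1}+1}^{\tau_i})$, where $r=r(a^n)$, $\tau_0=0$, $\tau_{r+1}=n$, and for $1\le i\le r$, $\tau_i$ is the smallest $t$ with $\sum_{j=1}^t\mathbf 1_{\{a_j\ne a_{j+1}\}}=i$ (the end of the $i$-th constant block), and $P^{(a)}(x_1^\ell)$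 denotes the probability the stationary process $P^{(a)}$ assigns to its first $\ell$ symbols being $x_1^\ell$. *)

theory Defs
  imports "HOL-Probability.Probability"
begin

text \<open>Conventions: time indices are 0-based (paper's t = our t+1); finite strings are lists.
 Alphabets X, Z, hat X are finite types; a process with values in a set A is a probability
 measure on the product space nat => A (product sigma-algebra).\<close>

definition seqM :: "(nat \<Rightarrow> 'a) measure" where
  "seqM = Pi\<^sub>M UNIV (\<lambda>_::nat. count_space (UNIV :: 'a set))"

definition is_process :: "(nat \<Rightarrow> 'a) measure \<Rightarrow> bool" where
  "is_process P \<longleftrightarrow> prob_space P \<and> sets P = sets seqM"

definition is_stationary :: "(nat \<Rightarrow> 'a) measure \<Rightarrow> bool" where
  "is_stationary P \<longleftrightarrow> is_process P \<and> distr P seqM (\<lambda>\<omega> i. \<omega> (Suc i)) = P"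

definition pfx :: "(nat \<Rightarrow> 'a) measure \<Rightarrow> 'a list \<Rightarrow> real" where
  "pfx P xs = measure P {\<omega> \<in> space P. \<forall>i<length xs. \<omega> i = xs ! i}"

definition nswitch :: "'a list \<Rightarrow> nat" where
  "nswitch as = card {j. Suc j < length as \<and> as ! j \<noteq> as ! Suc j}"

definition block_ends :: "'a list \<Rightarrow> nat list" where
  "block_ends as = sorted_list_of_set
     {t. 0 < t \<and> t \<le> length as \<and> (t = length as \<or> as ! (t - 1) \<noteq> as ! t)}"

definition block_prod :: "(nat \<Rightarrow> (nat \<Rightarrow> 'x) measure) \<Rightarrow> nat list \<Rightarrow> 'x list \<Rightarrow> real" where
  "block_prod Q as xs =
     (let \<tau> = block_ends as; st = 0 # \<tau> in
      \<Prod>i<length \<tau>. pfx (Q (as ! (\<tau> ! i - 1))) (take (\<tau> ! i - st ! i) (drop (st ! i) xs)))"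

definition classP :: "(nat \<Rightarrow> nat) \<Rightarrow> (nat \<Rightarrow> 'x) measure \<Rightarrow> bool" where
  "classP m P \<longleftrightarrow> is_process P \<and>
     (\<exists>M::nat. M \<ge> 1 \<and> (\<exists>(Q :: nat \<Rightarrow> (nat \<Rightarrow> 'x) measure) (A :: (nat \<Rightarrow> nat) measure).
        (\<forall>a\<in>{1..M}. is_stationary (Q a)) \<and> is_process A \<and>
        (AE \<omega> in A. \<forall>i. \<omega> i \<in> {1..M}) \<and>
        (\<forall>n. AE \<omega> in A. nswitch (map \<omega> [0..<n]) \<le> m n) \<and>
        (\<forall>xs. pfx P xs =
           (\<Sum>as\<in>{as. length as = length xs \<and> set as \<subseteq> {1..M}}. pfx A as * block_prod Q as xs))))"

definition stochastic :: "('x::finite \<Rightarrow> 'z::finite \<Rightarrow> real) \<Rightarrow> bool" where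
  "stochastic Ch \<longleftrightarrow> (\<forall>x z. Ch x z \<ge> 0) \<and> (\<forall>x. (\<Sum>z\<in>UNIV. Ch x z) = 1)"

definition full_row_rank :: "('x::finite \<Rightarrow> 'z::finite \<Rightarrow> real) \<Rightarrow> bool" where
  "full_row_rank Ch \<longleftrightarrow> (\<forall>c::'x \<Rightarrow> real. (\<forall>z. (\<Sum>x\<in>UNIV. c x * Ch x z) = 0) \<longrightarrow> (\<forall>x. c x = 0))"

definition right_inverse :: "('x::finite \<Rightarrow> 'z::finite \<Rightarrow> real) \<Rightarrow> ('z \<Rightarrow> 'x \<Rightarrow> real) \<Rightarrow> bool" where
  "right_inverse Ch H \<longleftrightarrow> (\<forall>x x'. (\<Sum>z\<in>UNIV. Ch x z * H z x') = (if x = x' then 1 else 0))"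

definition rho :: "('x::finite \<Rightarrow> 'z::finite \<Rightarrow> real) \<Rightarrow> ('x \<Rightarrow> 'xh \<Rightarrow> real) \<Rightarrow> 'x \<Rightarrow> ('z \<Rightarrow> 'xh) \<Rightarrow> real" where
  "rho Ch \<Lambda> x s = (\<Sum>z\<in>UNIV. \<Lambda> x (s z) * Ch x z)"

definition ell :: "('x::finite \<Rightarrow> 'z::finite \<Rightarrow> real) \<Rightarrow> ('z \<Rightarrow> 'x \<Rightarrow> real) \<Rightarrow> ('x \<Rightarrow> 'xh \<Rightarrow> real)
    \<Rightarrow> 'z \<Rightarrow> ('z \<Rightarrow> 'xh) \<Rightarrow> real" where
  "ell Ch H \<Lambda> z s = (\<Sum>x\<in>UNIV. H z x * rho Ch \<Lambda> x s)"

definition ell_max :: "('x::finite \<Rightarrow> 'z::finite \<Rightarrow> real) \<Rightarrow> ('z \<Rightarrow> 'x \<Rightarrow> real) \<Rightarrow> ('x \<Rightarrow> 'xh::finite \<Rightarrow> real) \<Rightarrow> real" where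
  "ell_max Ch H \<Lambda> = Max (range (\<lambda>(z, s). ell Ch H \<Lambda> z s)) - Min (range (\<lambda>(z, s). ell Ch H \<Lambda> z s))"

definition Lambda_max :: "('x::finite \<Rightarrow> 'xh::finite \<Rightarrow> real) \<Rightarrow> real" where
  "Lambda_max \<Lambda> = Max (range (\<lambda>(x, y). \<Lambda> x y))"

definition L_max :: "('x::finite \<Rightarrow> 'z::finite \<Rightarrow> real) \<Rightarrow> ('z \<Rightarrow> 'x \<Rightarrow> real) \<Rightarrow> ('x \<Rightarrow> 'xh::finite \<Rightarrow> real) \<Rightarrow> real" where
  "L_max Ch H \<Lambda> = Lambda_max \<Lambda> + ell_max Ch H \<Lambda>"

definition hb :: "real \<Rightarrow> real" where
  "hb x = (if x = 0 \<or> x = 1 then 0 else - x * ln x - (1 - x) * ln (1 - x))"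

text \<open>An n-block denoiser: D zs t is hat X_t(z^n) (t = 0..n-1).
 Expected loss E L(X^n, Z^n), with Z^n the memoryless channel output.\<close>
definition exp_loss :: "('x::finite \<Rightarrow> 'z::finite \<Rightarrow> real) \<Rightarrow> ('x \<Rightarrow> 'xh \<Rightarrow> real) \<Rightarrow> (nat \<Rightarrow> 'x) measure
    \<Rightarrow> nat \<Rightarrow> ('z list \<Rightarrow> nat \<Rightarrow> 'xh) \<Rightarrow> real" where
  "exp_loss Ch \<Lambda> P n D =
     (\<Sum>xs\<in>{xs. length xs = n}. \<Sum>zs\<in>{zs. length zs = n}.
        pfx P xs * (\<Prod>t<n. Ch (xs ! t) (zs ! t)) * ((1 / real n) * (\<Sum>t<n. \<Lambda> (xs ! t) (D zs t))))"

definition DD :: "('x::finite \<Rightarrow> 'z::finite \<Rightarrow> real) \<Rightarrow> ('x \<Rightarrow> 'xh \<Rightarrow> real) \<Rightarrow> (nat \<Rightarrow> 'x) measure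
    \<Rightarrow> nat \<Rightarrow> real" where
  "DD Ch \<Lambda> P n = (INF D. exp_loss Ch \<Lambda> P n D)"

text \<open>S-DUDE. Positions t with k <= t < n-k (paper: k+1..n-k).\<close>
definition ctx :: "nat \<Rightarrow> 'z list \<Rightarrow> nat \<Rightarrow> 'z list \<times> 'z list" where
  "ctx k zs t = (take k (drop (t - k) zs), take k (drop (Suc t) zs))"

definition Tset :: "nat \<Rightarrow> 'z list \<Rightarrow> 'z list \<times> 'z list \<Rightarrow> nat set" where
  "Tset k zs c = {t. k \<le> t \<and> t < length zs - k \<and> ctx k zs t = c}"

definition Skm :: "nat \<Rightarrow> nat \<Rightarrow> 'z list \<Rightarrow> (nat \<Rightarrow> ('z \<Rightarrow> 'xh)) set" where
  "Skm k m zs = {\<sigma>. \<forall>c. card {(i, j). i \<in> Tset k zs c \<and> j \<in> Tset k zs c \<and> i < j \<and>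
       (\<forall>l\<in>Tset k zs c. \<not> (i < l \<and> l < j)) \<and> \<sigma> i \<noteq> \<sigma> j} \<le> m}"

definition sdude_cost :: "('x::finite \<Rightarrow> 'z::finite \<Rightarrow> real) \<Rightarrow> ('z \<Rightarrow> 'x \<Rightarrow> real) \<Rightarrow> ('x \<Rightarrow> 'xh \<Rightarrow> real)
    \<Rightarrow> nat \<Rightarrow> 'z list \<Rightarrow> (nat \<Rightarrow> ('z \<Rightarrow> 'xh)) \<Rightarrow> real" where
  "sdude_cost Ch H \<Lambda> k zs \<sigma> =
     (1 / real (length zs - 2 * k)) * (\<Sum>t\<in>{k..<length zs - k}. ell Ch H \<Lambda> (zs ! t) (\<sigma> t))"

text \<open>D is a (k,m)-S-DUDE for block length n (any tie-breaking among minimizers).\<close>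
definition is_sdude :: "('x::finite \<Rightarrow> 'z::finite \<Rightarrow> real) \<Rightarrow> ('z \<Rightarrow> 'x \<Rightarrow> real) \<Rightarrow> ('x \<Rightarrow> 'xh \<Rightarrow> real)
    \<Rightarrow> nat \<Rightarrow> nat \<Rightarrow> nat \<Rightarrow> ('z list \<Rightarrow> nat \<Rightarrow> 'xh) \<Rightarrow> bool" where
  "is_sdude Ch H \<Lambda> k m n D \<longleftrightarrow> (\<exists>x0. \<forall>zs. length zs = n \<longrightarrow>
     (\<exists>\<sigma>\<in>Skm k m zs. (\<forall>\<sigma>'\<in>Skm k m zs. sdude_cost Ch H \<Lambda> k zs \<sigma> \<le> sdude_cost Ch H \<Lambda> k zs \<sigma>') \<and>
        (\<forall>t<n. D zs t = (if k \<le> t \<and> t < n - k then \<sigma> t (zs ! t) else x0))))"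

end

theory Submission
  imports Defs "HOL-Library.Sublist"
begin

text \<open>
  Condition on the regime string \<open>A\<^sup>n\<close>. The law of \<open>X\<^sup>n\<close> is then a product of stationary blocks, so
  a denoiser that even knows \<open>A\<^sup>n\<close> cannot at time \<open>t\<close> beat the Bayes risk of observing the current
  block. By stationarity this risk is at least the limit of the decreasing sequence of risks of the
  best \<open>k\<close>-window denoisers of the current stationary source.

  Conversely, the genie that uses the best \<open>k\<close>-window rule of the current source has at most \<open>m\<close>
  shifts along each context and attains risk close to this limit except within distance \<open>k\<close> of the
  at most \<open>m\<close> switches. The S-DUDE minimizes the estimated loss, which is unbiased for every rule
  sequence that does not look at the current symbol. So it remains to bound, uniformly over all rule
  sequences with at most \<open>m\<close> shifts per context, how far the true loss exceeds its estimate. Along a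
  residue class modulo \<open>k + 1\<close> the deviations are independent given the contexts, hence Hoeffding's
  lemma and a count of the admissible sequences suffice. Summability forces the logarithm of this
  count, times \<open>(k + 1) / (n - 2k)\<close>, and also \<open>(k + 1) (m + 1) / (n - 2k)\<close> to vanish.
\<close>

subsection \<open>Words and the memoryless channel\<close>

abbreviation words :: "nat \<Rightarrow> 'a list set" where
  "words n \<equiv> {xs. length xs = n}"

lemma finite_words [simp]: "finite (words n :: 'a::finite list set)"
  using finite_lists_length_eq[of "UNIV :: 'a set" n] by simp

lemma card_words: "card (words n :: 'a::finite list set) = CARD('a) ^ n"
  using card_lists_length_eq[of "UNIV :: 'a set" n] by simp

lemma sum_words_append:
  fixes f :: "'a list \<Rightarrow> 'b::comm_monoid_add"
  shows "(\<Sum>xs\<in>words (a + b). f xs) = (\<Sum>u\<in>words a. \<Sum>v\<in>words b. f (u @ v))"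
  unfolding sum.cartesian_product
  by (rule sum.reindex_bij_witness
      [where i = "\<lambda>(u, v). u @ v" and j = "\<lambda>xs. (take a xs, drop a xs)"]) auto

lemma sum_words_Suc:
  fixes f :: "'a list \<Rightarrow> 'b::comm_monoid_add"
  shows "(\<Sum>xs\<in>words (Suc n). f xs) = (\<Sum>x\<in>UNIV. \<Sum>v\<in>words n. f (x # v))"
  unfolding sum.cartesian_product
  by (rule sum.reindex_bij_witness
      [where i = "\<lambda>(u, v). u # v" and j = "\<lambda>xs. (hd xs, tl xs)"]) (auto simp: length_Suc_conv)

definition channel_mean :: "('x \<Rightarrow> 'z \<Rightarrow> real) \<Rightarrow> 'x list \<Rightarrow> ('z list \<Rightarrow> real) \<Rightarrow> real" where
  "channel_mean Ch xs F = (\<Sum>zs\<in>words (length xs). (\<Prod>t<length xs. Ch (xs ! t) (zs ! t)) * F zs)"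

lemma channel_mean_cong:
  "(\<And>zs. length zs = length xs \<Longrightarrow> F zs = G zs) \<Longrightarrow> channel_mean Ch xs F = channel_mean Ch xs G"
  by (simp add: channel_mean_def)

lemma channel_mean_Nil [simp]: "channel_mean Ch [] F = F []"
  by (simp add: channel_mean_def)

lemma channel_mean_Cons [simp]:
  "channel_mean Ch (x # xs) F = (\<Sum>z\<in>UNIV. Ch x z * channel_mean Ch xs (\<lambda>zs. F (z # zs)))"
  by (simp add: channel_mean_def sum_words_Suc prod.lessThan_Suc_shift sum_distrib_left mult.assoc
      del: prod.lessThan_Suc)

lemma channel_mean_append:
  "channel_mean Ch (u @ v) F = channel_mean Ch u (\<lambda>zu. channel_mean Ch v (\<lambda>zv. F (zu @ zv)))"
  by (induction u arbitrary: F) simp_all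

lemma channel_mean_cmult: "channel_mean Ch xs (\<lambda>zs. c * F zs) = c * channel_mean Ch xs F"
  by (simp add: channel_mean_def sum_distrib_left mult.left_commute)

lemma channel_mean_sum:
  "channel_mean Ch xs (\<lambda>zs. \<Sum>i\<in>I. F i zs) = (\<Sum>i\<in>I. channel_mean Ch xs (F i))"
  unfolding channel_mean_def sum_distrib_left by (rule sum.swap)

lemma channel_mean_add:
  "channel_mean Ch xs (\<lambda>zs. F zs + G zs) = channel_mean Ch xs F + channel_mean Ch xs G"
  by (simp add: channel_mean_def distrib_left sum.distrib)

lemma channel_mean_swap:
  "channel_mean Ch xs (\<lambda>zs. channel_mean Ch ys (F zs))
    = channel_mean Ch ys (\<lambda>ws. channel_mean Ch xs (\<lambda>zs. F zs ws))"
proof -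
  have "channel_mean Ch xs (\<lambda>zs. channel_mean Ch ys (F zs))
    = (\<Sum>ws\<in>words (length ys).
        channel_mean Ch xs (\<lambda>zs. (\<Prod>t<length ys. Ch (ys ! t) (ws ! t)) * F zs ws))"
    by (simp add: channel_mean_def[of Ch ys] channel_mean_sum)
  then show ?thesis
    by (simp add: channel_mean_cmult) (simp add: channel_mean_def[of Ch ys])
qed

locale memoryless_channel =
  fixes Ch :: "'x::finite \<Rightarrow> 'z::finite \<Rightarrow> real"
  assumes stochastic: "stochastic Ch"
begin

abbreviation \<E> :: "'x list \<Rightarrow> ('z list \<Rightarrow> real) \<Rightarrow> real" where
  "\<E> \<equiv> channel_mean Ch"

lemma Ch_nonneg: "0 \<le> Ch x z"
  using stochastic by (simp add: stochastic_def)

lemma sum_Ch: "(\<Sum>z\<in>UNIV. Ch x z) = 1"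
  using stochastic by (simp add: stochastic_def)

lemma channel_mean_mono:
  assumes "\<And>zs. length zs = length xs \<Longrightarrow> F zs \<le> G zs"
  shows "\<E> xs F \<le> \<E> xs G"
  unfolding channel_mean_def using assms
  by (intro sum_mono mult_left_mono prod_nonneg) (auto simp: Ch_nonneg)

lemma channel_mean_const [simp]: "\<E> xs (\<lambda>_. c) = c"
  by (induction xs) (simp_all add: sum_Ch flip: sum_distrib_right)

lemma channel_mean_nonneg: "(\<And>zs. 0 \<le> F zs) \<Longrightarrow> 0 \<le> \<E> xs F"
  using channel_mean_mono[of xs "\<lambda>_. 0" F] by simp

lemma channel_mean_window:
  assumes "length u = a" "length v = n"
  shows "\<E> (u @ v @ w) (\<lambda>zs. F (take n (drop a zs))) = \<E> v F"
proof -
  have "\<E> (u @ v @ w) (\<lambda>zs. F (take n (drop a zs))) = \<E> u (\<lambda>zu. \<E> v (\<lambda>zv. \<E> w (\<lambda>zw. F zv)))"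
    unfolding channel_mean_append using assms by (intro channel_mean_cong) simp
  then show ?thesis by simp
qed

lemma channel_mean_resample:
  "t < length xs \<Longrightarrow> \<E> xs F = \<E> xs (\<lambda>zs. \<Sum>z\<in>UNIV. Ch (xs ! t) z * F (zs[t := z]))"
proof (induction xs arbitrary: t F)
  case (Cons x xs)
  show ?case
  proof (cases t)
    case 0
    then show ?thesis
      by (simp add: channel_mean_sum channel_mean_cmult sum_Ch flip: sum_distrib_right)
  next
    case (Suc t')
    then have "t' < length xs" using Cons.prems by simp
    then have "\<E> xs (\<lambda>zs. F (z # zs)) =
        \<E> xs (\<lambda>zs. \<Sum>y\<in>UNIV. Ch (xs ! t') y * F (z # zs[t' := y]))" for z
      by (rule Cons.IH)
    then show ?thesis using Suc by simp
  qed
qed simp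

lemma channel_mean_prod_le:
  assumes T: "T \<subseteq> {..<length xs}"
    and \<phi>_update: "\<And>t zs z. t \<in> T \<Longrightarrow> length zs = length xs \<Longrightarrow> \<phi> (zs[t := z]) = \<phi> zs"
    and nonneg: "\<And>zs. 0 \<le> \<phi> zs" "\<And>t z. 0 \<le> g t z"
    and g_mean: "\<And>t. t \<in> T \<Longrightarrow> (\<Sum>z\<in>UNIV. Ch (xs ! t) z * g t z) \<le> b" and "0 \<le> b"
  shows "\<E> xs (\<lambda>zs. \<phi> zs * (\<Prod>t\<in>T. g t (zs ! t))) \<le> b ^ card T * \<E> xs \<phi>"
  using finite_subset[OF T finite_lessThan] T \<phi>_update g_mean
proof (induction T rule: finite_induct)
  case (insert t T)
  let ?G = "\<lambda>zs. \<phi> zs * (\<Prod>s\<in>T. g s (zs ! s))"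
  have t: "t < length xs" using insert.prems by simp
  have G_update: "?G (zs[t := z]) = ?G zs" if "length zs = length xs" for zs z
  proof -
    have "(\<Prod>s\<in>T. g s (zs[t := z] ! s)) = (\<Prod>s\<in>T. g s (zs ! s))"
      using insert.hyps by (intro prod.cong refl) (metis nth_list_update_neq)
    then show ?thesis using insert.prems(2)[of t zs z] that by simp
  qed
  have "\<E> xs (\<lambda>zs. \<phi> zs * (\<Prod>s\<in>insert t T. g s (zs ! s))) = \<E> xs (\<lambda>zs. ?G zs * g t (zs ! t))"
    using insert.hyps by (simp add: mult_ac)
  also have "\<dots> = \<E> xs (\<lambda>zs. (\<Sum>z\<in>UNIV. Ch (xs ! t) z * g t z) * ?G zs)"
    unfolding channel_mean_resample[OF t, of "\<lambda>zs. ?G zs * g t (zs ! t)"] sum_distrib_right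
    using t G_update by (intro channel_mean_cong sum.cong refl) (simp add: mult_ac)
  also have "\<dots> = (\<Sum>z\<in>UNIV. Ch (xs ! t) z * g t z) * \<E> xs ?G"
    by (rule channel_mean_cmult)
  also have "\<dots> \<le> b * (b ^ card T * \<E> xs \<phi>)"
  proof (rule mult_mono)
    show "\<E> xs ?G \<le> b ^ card T * \<E> xs \<phi>" using insert.prems by (intro insert.IH) auto
    show "0 \<le> \<E> xs ?G"
      by (intro channel_mean_nonneg mult_nonneg_nonneg prod_nonneg) (auto simp: nonneg)
  qed (use insert.prems \<open>0 \<le> b\<close> in auto)
  finally show ?case using insert.hyps by simp
qed simp

end

subsection \<open>Exponential moments\<close>

lemma Hoeffding_lemma_finite:
  fixes p f :: "'a::finite \<Rightarrow> real"
  assumes p: "\<And>x. 0 \<le> p x" "(\<Sum>x\<in>UNIV. p x) = 1"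
    and mean: "(\<Sum>x\<in>UNIV. p x * f x) = 0"
    and width: "\<And>x y. f x - f y \<le> c" and "0 < l"
  shows "(\<Sum>x\<in>UNIV. p x * exp (l * f x)) \<le> exp (l\<^sup>2 * c\<^sup>2 / 8)"
proof -
  define M where "M = embed_pmf p"
  have pmf_M: "pmf M x = p x" for x
    unfolding M_def
    by (rule pmf_embed_pmf) (use p in \<open>simp_all add: nn_integral_count_space_finite\<close>)
  have expectation: "measure_pmf.expectation M g = (\<Sum>x\<in>UNIV. p x * g x)" for g :: "'a \<Rightarrow> real"
    by (subst integral_measure_pmf_real[where A = UNIV]) (simp_all add: pmf_M mult.commute)
  interpret interval_bounded_random_variable M f "Min (range f)" "Max (range f)"
    by unfold_locales (auto intro!: AE_pmfI)
  have "ennreal (\<Sum>x\<in>UNIV. p x * exp (l * f x)) = (\<integral>\<^sup>+x. exp (l * f x) \<partial>M)"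
    unfolding expectation[symmetric]
    by (rule nn_integral_eq_integral[symmetric]) (auto intro!: integrable_measure_pmf_finite)
  also have "\<dots> \<le> ennreal (exp (l\<^sup>2 * (Max (range f) - Min (range f))\<^sup>2 / 8))"
    by (rule Hoeffdings_lemma_nn_integral_0) (simp_all add: \<open>0 < l\<close> expectation mean)
  finally have "(\<Sum>x\<in>UNIV. p x * exp (l * f x)) \<le> exp (l\<^sup>2 * (Max (range f) - Min (range f))\<^sup>2 / 8)"
    by simp
  also have "\<dots> \<le> exp (l\<^sup>2 * c\<^sup>2 / 8)"
  proof -
    have "Max (range f) \<in> range f" "Min (range f) \<in> range f" by (auto intro: Max_in Min_in)
    then have "Max (range f) - Min (range f) \<le> c" using width by (metis imageE)
    moreover have "0 \<le> Max (range f) - Min (range f)" by (simp add: Min_le_iff)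
    ultimately show ?thesis by (simp add: mult_left_mono power_mono)
  qed
  finally show ?thesis .
qed

lemma le_two_sqrt_mult:
  fixes a b y :: real
  assumes "0 \<le> a" "0 \<le> b" and le: "\<And>l. 0 < l \<Longrightarrow> y \<le> a / l + l * b"
  shows "y \<le> 2 * sqrt (a * b)"
proof (rule tendsto_lowerbound)
  show "((\<lambda>e. 2 * (sqrt (a + e) * sqrt (b + e))) \<longlongrightarrow> 2 * sqrt (a * b)) (at_right 0)"
    by (auto intro!: tendsto_eq_intros simp: real_sqrt_mult)
  show "eventually (\<lambda>e. y \<le> 2 * (sqrt (a + e) * sqrt (b + e))) (at_right 0)"
    using eventually_at_right_less[of 0]
  proof eventually_elim
    case (elim e)
    define u v where "u = sqrt (a + e)" and "v = sqrt (b + e)"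
    have uv: "0 < u" "0 < v" "a \<le> u\<^sup>2" "b \<le> v\<^sup>2" using assms elim by (simp_all add: u_def v_def)
    have "y \<le> a / (u / v) + u / v * b" using uv by (intro le) simp
    also have "\<dots> \<le> u\<^sup>2 / (u / v) + u / v * v\<^sup>2"
      using uv by (intro add_mono divide_right_mono mult_left_mono) simp_all
    also have "\<dots> = 2 * (u * v)" using uv by (simp add: power2_eq_square)
    finally show ?case by (simp add: u_def v_def)
  qed
qed simp

context memoryless_channel
begin

lemma channel_mean_le_of_exp_moment:
  assumes "\<E> xs (\<lambda>zs. exp (l * S zs)) \<le> exp c" "0 < l"
  shows "\<E> xs S \<le> c / l"
proof -
  \<comment> \<open>The tangent of \<open>exp\<close> at \<open>c\<close> takes the place of Jensen's inequality.\<close>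
  have "\<E> xs (\<lambda>zs. l * S zs) \<le> \<E> xs (\<lambda>zs. (c - 1) + exp (- c) * exp (l * S zs))"
  proof (rule channel_mean_mono)
    fix zs
    show "l * S zs \<le> (c - 1) + exp (- c) * exp (l * S zs)"
      using exp_ge_add_one_self[of "l * S zs - c"]
      by (simp add: exp_diff exp_minus divide_inverse mult_ac)
  qed
  also have "\<dots> = (c - 1) + exp (- c) * \<E> xs (\<lambda>zs. exp (l * S zs))"
    by (simp add: channel_mean_add channel_mean_cmult)
  also have "\<dots> \<le> (c - 1) + exp (- c) * exp c"
    using assms(1) by simp
  finally show ?thesis
    using assms(2) by (simp add: channel_mean_cmult field_simps exp_minus)
qed

text \<open>Since \<open>fam\<close> does not depend on the symbols at the positions in \<open>T\<close>, the expectation may be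
  bounded by a sum over all members, in each of which these symbols are independent of \<open>fam\<close>.\<close>

lemma channel_mean_selected_sum_le:
  fixes f :: "nat \<Rightarrow> 'z \<Rightarrow> 's \<Rightarrow> real" and fam :: "'z list \<Rightarrow> 's set"
  assumes T: "T \<subseteq> {..<length xs}"
    and fam: "finite U" "\<And>zs. fam zs \<subseteq> U"
      "\<And>zs. length zs = length xs \<Longrightarrow> real (card (fam zs)) \<le> exp \<kappa>"
      "\<And>t zs z. t \<in> T \<Longrightarrow> fam (zs[t := z]) = fam zs"
    and mean: "\<And>t s. t \<in> T \<Longrightarrow> (\<Sum>z\<in>UNIV. Ch (xs ! t) z * f t z s) = 0"
    and width: "\<And>t z z' s. t \<in> T \<Longrightarrow> f t z s - f t z' s \<le> c" and l: "0 < l"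
    and \<sigma>: "\<And>zs. length zs = length xs \<Longrightarrow> \<sigma> zs \<in> fam zs"
  shows "\<E> xs (\<lambda>zs. \<Sum>t\<in>T. f t (zs ! t) (\<sigma> zs)) \<le> (\<kappa> + real (card T) * (l\<^sup>2 * c\<^sup>2 / 8)) / l"
proof (rule channel_mean_le_of_exp_moment[OF _ l])
  let ?S = "\<lambda>zs s. \<Sum>t\<in>T. f t (zs ! t) s" and ?b = "exp (l\<^sup>2 * c\<^sup>2 / 8)"
  have finite_T: "finite T" using T finite_subset by blast
  have exp_S: "exp (l * ?S zs s) = (\<Prod>t\<in>T. exp (l * f t (zs ! t) s))" for zs s
    by (simp add: sum_distrib_left exp_sum[OF finite_T])
  have "\<E> xs (\<lambda>zs. exp (l * ?S zs (\<sigma> zs)))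
    \<le> \<E> xs (\<lambda>zs. \<Sum>s\<in>U. indicator (fam zs) s * exp (l * ?S zs s))"
  proof (rule channel_mean_mono)
    fix zs :: "'z list" assume "length zs = length xs"
    then have "\<sigma> zs \<in> fam zs" by (rule \<sigma>)
    then show "exp (l * ?S zs (\<sigma> zs)) \<le> (\<Sum>s\<in>U. indicator (fam zs) s * exp (l * ?S zs s))"
      using member_le_sum[of "\<sigma> zs" U "\<lambda>s. indicator (fam zs) s * exp (l * ?S zs s)"] fam(1,2)
      by (auto simp: subset_iff)
  qed
  also have "\<dots> = (\<Sum>s\<in>U. \<E> xs (\<lambda>zs. indicator (fam zs) s * exp (l * ?S zs s)))"
    by (rule channel_mean_sum)
  also have "\<dots> \<le> (\<Sum>s\<in>U. ?b ^ card T * \<E> xs (\<lambda>zs. indicator (fam zs) s))"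
    unfolding exp_S
    by (intro sum_mono channel_mean_prod_le T Hoeffding_lemma_finite)
      (auto simp: fam(4) Ch_nonneg sum_Ch mean width l)
  also have "\<dots> = ?b ^ card T * \<E> xs (\<lambda>zs. \<Sum>s\<in>U. indicator (fam zs) s)"
    by (simp only: channel_mean_sum sum_distrib_left)
  also have "\<dots> \<le> ?b ^ card T * \<E> xs (\<lambda>zs. exp \<kappa>)"
  proof (intro mult_left_mono channel_mean_mono)
    fix zs :: "'z list" assume zs: "length zs = length xs"
    have "(\<Sum>s\<in>U. indicator (fam zs) s) = real (card (U \<inter> fam zs))"
      using fam(1) by (simp add: indicator_def of_bool_def sum.If_cases)
    then show "(\<Sum>s\<in>U. indicator (fam zs) s) \<le> exp \<kappa>"
      using fam(2)[of zs] fam(3)[OF zs] by (simp add: Int_absorb1)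
  qed simp
  also have "\<dots> = exp (\<kappa> + real (card T) * (l\<^sup>2 * c\<^sup>2 / 8))"
    by (simp only: exp_add exp_of_nat_mult channel_mean_const mult.commute)
  finally show "\<E> xs (\<lambda>zs. exp (l * ?S zs (\<sigma> zs))) \<le> exp (\<kappa> + real (card T) * (l\<^sup>2 * c\<^sup>2 / 8))" .
qed

end

subsection \<open>Sequences with few switches\<close>

lemma nswitch_Nil [simp]: "nswitch [] = 0"
  and nswitch_singleton [simp]: "nswitch [x] = 0"
  by (simp_all add: nswitch_def)

lemma nswitch_Cons_Cons [simp]:
  "nswitch (x # y # xs) = (if x = y then 0 else 1) + nswitch (y # xs)"
proof -
  let ?J = "\<lambda>xs. {j. Suc j < length xs \<and> xs ! j \<noteq> xs ! Suc j}"
  have "?J (x # y # xs) = (if x = y then {} else {0}) \<union> Suc ` ?J (y # xs)"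
  proof (rule set_eqI)
    fix j
    show "j \<in> ?J (x # y # xs) \<longleftrightarrow> j \<in> (if x = y then {} else {0}) \<union> Suc ` ?J (y # xs)"
      by (cases j) auto
  qed
  moreover have "finite (?J (y # xs))" by (rule finite_subset[of _ "{..length xs}"]) auto
  ultimately show ?thesis by (simp add: nswitch_def card_image)
qed

lemma nswitch_map_le: "nswitch (map f xs) \<le> nswitch xs"
  by (induction xs rule: induct_list012) auto

lemma nswitch_Cons_le: "nswitch (x # xs) \<le> nswitch (x # y # xs)"
  by (cases xs) auto

lemma nswitch_subseq:
  assumes "subseq ys xs"
  shows "nswitch ys \<le> nswitch xs"
proof -
  have Cons: "nswitch (x # ys) \<le> nswitch (x # xs)" if "subseq ys xs" for x ys and xs :: "'a list"
    using that
  proof (induction arbitrary: x rule: list_emb.induct)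
    case (list_emb_Cons ys xs y)
    have "nswitch (x # ys) \<le> nswitch (x # xs)" by (rule list_emb_Cons.IH)
    also have "\<dots> \<le> nswitch (x # y # xs)" by (rule nswitch_Cons_le)
    finally show ?case .
  next
    case (list_emb_Cons2 y z ys xs)
    then show ?case using list_emb_Cons2.IH[of x] list_emb_Cons2.IH[of z] by simp
  next
    case (list_emb_Nil xs)
    then show ?case by simp
  qed
  show ?thesis
    using assms
  proof (induction rule: list_emb.induct)
    case (list_emb_Cons ys xs y)
    moreover have "nswitch xs \<le> nswitch (y # xs)" by (cases xs) auto
    ultimately show ?case by simp
  qed (auto intro: Cons)
qed

definition near_switch :: "nat \<Rightarrow> 'a list \<Rightarrow> nat set" where
  "near_switch k as = {t. \<exists>j. t \<le> j + k \<and> j < t + k \<and> Suc j < length as \<and> as ! j \<noteq> as ! Suc j}"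

lemma finite_near_switch: "finite (near_switch k as)"
  by (rule finite_subset[of _ "{..length as + k}"]) (auto simp: near_switch_def)

lemma card_near_switch_le: "card (near_switch k as) \<le> 2 * k * nswitch as"
proof -
  let ?J = "{j. Suc j < length as \<and> as ! j \<noteq> as ! Suc j}"
  have finite_J: "finite ?J" by (rule finite_subset[of _ "{..<length as}"]) auto
  have "card (near_switch k as) \<le> card (\<Union>j\<in>?J. {j + 1 - k..j + k})"
    by (rule card_mono) (use finite_J in \<open>auto simp: near_switch_def\<close>)
  also have "\<dots> \<le> (\<Sum>j\<in>?J. card {j + 1 - k..j + k})" by (rule card_UN_le[OF finite_J])
  also have "\<dots> \<le> (\<Sum>j\<in>?J. 2 * k)" by (rule sum_mono) auto
  finally show ?thesis by (simp add: nswitch_def mult.commute)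
qed

lemma subseq_sorted_list_of_set:
  assumes "finite B" "A \<subseteq> B"
  shows "subseq (sorted_list_of_set A) (sorted_list_of_set B)"
proof -
  have "sorted_list_of_set A = filter (\<lambda>x. x \<in> A) (sorted_list_of_set B)"
    using assms finite_subset[OF assms(2,1)]
    by (intro sorted_distinct_set_unique) (auto intro: sorted_wrt_filter)
  then show ?thesis by simp
qed

lemma card_consecutive_changes_eq_nswitch:
  fixes T :: "nat set"
  assumes "finite T"
  shows "card {(i, j). i \<in> T \<and> j \<in> T \<and> i < j \<and> (\<forall>l\<in>T. \<not> (i < l \<and> l < j)) \<and> \<sigma> i \<noteq> \<sigma> j}
    = nswitch (map \<sigma> (sorted_list_of_set T))"
proof -
  define L where "L = sorted_list_of_set T"
  have set_L: "set L = T" using assms by (simp add: L_def)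
  have less_iff: "L ! p < L ! q \<longleftrightarrow> p < q" if "p < length L" "q < length L" for p q
    using that sorted_wrt_nth_less[OF strict_sorted_list_of_set[of T, folded L_def]]
    by (metis nat_neq_iff not_less_iff_gr_or_eq)
  let ?J = "{p. Suc p < length L \<and> \<sigma> (L ! p) \<noteq> \<sigma> (L ! Suc p)}"
  have "{(i, j). i \<in> T \<and> j \<in> T \<and> i < j \<and> (\<forall>l\<in>T. \<not> (i < l \<and> l < j)) \<and> \<sigma> i \<noteq> \<sigma> j}
    = (\<lambda>p. (L ! p, L ! Suc p)) ` ?J" (is "?pairs = _")
  proof (intro equalityI subsetI)
    fix e assume "e \<in> ?pairs"
    then obtain p q where e: "e = (L ! p, L ! q)" and pq: "p < length L" "q < length L"
      and "L ! p < L ! q" "\<sigma> (L ! p) \<noteq> \<sigma> (L ! q)"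
      and between: "\<And>r. r < length L \<Longrightarrow> \<not> (L ! p < L ! r \<and> L ! r < L ! q)"
      unfolding set_L[symmetric] in_set_conv_nth by auto
    moreover from this have "p < q" by (simp add: less_iff)
    moreover from this have "\<not> Suc p < q"
      using between[of "Suc p"] pq by (simp add: less_iff)
    ultimately show "e \<in> (\<lambda>p. (L ! p, L ! Suc p)) ` ?J"
      by (metis (mono_tags, lifting) Suc_lessI image_eqI mem_Collect_eq)
  next
    fix e assume "e \<in> (\<lambda>p. (L ! p, L ! Suc p)) ` ?J"
    then obtain p where p: "e = (L ! p, L ! Suc p)" "Suc p < length L" "\<sigma> (L ! p) \<noteq> \<sigma> (L ! Suc p)"
      by auto
    moreover have "\<forall>l\<in>T. \<not> (L ! p < l \<and> l < L ! Suc p)"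
      unfolding set_L[symmetric] using p(2) by (auto simp: in_set_conv_nth less_iff)
    ultimately show "e \<in> ?pairs"
      unfolding set_L[symmetric] by (simp add: less_iff)
  qed
  moreover have "inj_on (\<lambda>p. (L ! p, L ! Suc p)) ?J"
    by (rule inj_onI)
      (metis (no_types, lifting) Pair_inject Suc_lessD less_iff linorder_neq_iff mem_Collect_eq)
  ultimately show ?thesis
    by (simp add: card_image nswitch_def L_def cong: conj_cong)
qed

definition few_switch_words :: "nat \<Rightarrow> nat \<Rightarrow> 'b list set" where
  "few_switch_words n m = {xs \<in> words n. nswitch xs \<le> m}"

lemma finite_few_switch_words: "finite (few_switch_words n m :: 'b::finite list set)"
  unfolding few_switch_words_def by (rule finite_subset[OF _ finite_words[of n]]) auto

lemma card_few_switch_words_0_switches: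
  "card (few_switch_words (Suc (Suc n)) 0 :: 'b::finite list set)
    \<le> card (few_switch_words (Suc n) 0 :: 'b list set)"
proof (rule surj_card_le[OF finite_few_switch_words])
  show "few_switch_words (Suc (Suc n)) 0 \<subseteq> (\<lambda>ys. hd ys # ys) ` few_switch_words (Suc n) 0"
    by (auto simp: few_switch_words_def length_Suc_conv image_iff split: if_splits)
qed

lemma card_few_switch_words_Suc_switches:
  "card (few_switch_words (Suc (Suc n)) (Suc m) :: 'b::finite list set)
    \<le> card (few_switch_words (Suc n) (Suc m) :: 'b list set)
      + CARD('b) * card (few_switch_words (Suc n) m :: 'b list set)"
proof -
  let ?repeat_first = "(\<lambda>ys. hd ys # ys) ` few_switch_words (Suc n) (Suc m) :: 'b list set"
  let ?change_first = "(\<lambda>(x, ys). x # ys) ` (UNIV \<times> few_switch_words (Suc n) m) :: 'b list set"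
  have "few_switch_words (Suc (Suc n)) (Suc m) \<subseteq> ?repeat_first \<union> ?change_first"
    by (fastforce simp: few_switch_words_def length_Suc_conv image_iff split: if_splits)
  then have "card (few_switch_words (Suc (Suc n)) (Suc m) :: 'b list set)
    \<le> card (?repeat_first \<union> ?change_first)"
    by (rule card_mono[rotated]) (simp add: finite_few_switch_words)
  also have "\<dots> \<le> card ?repeat_first + card ?change_first" by (rule card_Un_le)
  also have "\<dots> \<le> card (few_switch_words (Suc n) (Suc m) :: 'b list set)
      + card ((UNIV :: 'b set) \<times> (few_switch_words (Suc n) m :: 'b list set))"
    by (intro add_mono card_image_le) (simp_all add: finite_few_switch_words)
  finally show ?thesis by (simp add: card_cartesian_product)
qed

lemma card_few_switch_words_le:
  "card (few_switch_words n m :: 'b::finite list set) \<le> CARD('b) ^ (m + 1) * (\<Sum>j\<le>m. n choose j)"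
proof (induction n arbitrary: m rule: induct_nat_012)
  case 0
  have "few_switch_words 0 m = {[] :: 'b list}" by (auto simp: few_switch_words_def)
  then show ?case by (simp add: Suc_le_eq sum_pos2[of _ 0])
next
  case 1
  have "card (few_switch_words 1 m :: 'b list set) \<le> card (words 1 :: 'b list set)"
    by (intro card_mono) (auto simp: few_switch_words_def)
  also have "\<dots> \<le> CARD('b) ^ (m + 1) * 1"
    by (simp add: card_words)
  also have "\<dots> \<le> CARD('b) ^ (m + 1) * (\<Sum>j\<le>m. 1 choose j)"
    by (intro mult_left_mono) (auto simp: Suc_le_eq sum_pos2[of _ 0])
  finally show ?case by simp
next
  case (ge2 n)
  show ?case
  proof (cases m)
    case 0
    then show ?thesis
      using order_trans[OF card_few_switch_words_0_switches ge2.IH(2)[of 0]] by simp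
  next
    case (Suc m')
    have "card (few_switch_words (Suc (Suc n)) m :: 'b list set)
      \<le> CARD('b) ^ (m + 1) * (\<Sum>j\<le>m. Suc n choose j)
        + CARD('b) * (CARD('b) ^ (m' + 1) * (\<Sum>j\<le>m'. Suc n choose j))"
      unfolding Suc
      by (intro order_trans[OF card_few_switch_words_Suc_switches] add_mono mult_left_mono
          ge2.IH(2)) simp
    also have "\<dots> = CARD('b) ^ (m + 1) * ((\<Sum>j\<le>m. Suc n choose j) + (\<Sum>j\<le>m'. Suc n choose j))"
      using Suc by (simp add: distrib_left)
    also have "(\<Sum>j\<le>m. Suc n choose j) + (\<Sum>j\<le>m'. Suc n choose j) = (\<Sum>j\<le>m. Suc (Suc n) choose j)"
      unfolding Suc by (simp add: sum.atMost_Suc_shift sum.distrib del: sum.atMost_Suc)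
    finally show ?thesis .
  qed
qed

lemma sum_binomial_le_exp_hb:
  assumes "0 < n" "2 * m \<le> n"
  shows "real (\<Sum>j\<le>m. n choose j) \<le> exp (real n * hb (real m / real n))"
proof (cases "m = 0")
  case True
  then show ?thesis by (simp add: hb_def)
next
  case False
  define p where "p = real m / real n"
  have p: "0 < p" "p \<le> 1 / 2" "p < 1"
    using assms False by (auto simp: p_def field_simps)
  have np: "real n * p = real m" using assms by (simp add: p_def)
  have exp_hb: "exp (- real n * hb p) = p ^ m * (1 - p) ^ (n - m)"
  proof -
    have "- real n * hb p = real n * p * ln p + (real n - real n * p) * ln (1 - p)"
      using p by (simp add: hb_def algebra_simps)
    then have "- real n * hb p = real m * ln p + real (n - m) * ln (1 - p)"
      using assms by (simp add: np of_nat_diff)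
    then show ?thesis using p by (simp add: exp_add exp_of_nat_mult)
  qed
  have "(\<Sum>j\<le>m. real (n choose j)) * exp (- real n * hb p)
    \<le> (\<Sum>j\<le>m. real (n choose j) * p ^ j * (1 - p) ^ (n - j))"
    unfolding exp_hb sum_distrib_right
  proof (rule sum_mono)
    fix j assume "j \<in> {..m}"
    then have j: "m = j + (m - j)" "n - j = (m - j) + (n - m)" using assms by auto
    have "p ^ m * (1 - p) ^ (n - m) = p ^ j * p ^ (m - j) * (1 - p) ^ (n - m)"
      using j(1) by (metis power_add)
    also have "\<dots> \<le> p ^ j * (1 - p) ^ (m - j) * (1 - p) ^ (n - m)"
      using p by (intro mult_right_mono mult_left_mono power_mono) auto
    also have "\<dots> = p ^ j * (1 - p) ^ (n - j)"
      unfolding j(2) by (simp add: power_add)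
    finally show "real (n choose j) * (p ^ m * (1 - p) ^ (n - m))
      \<le> real (n choose j) * p ^ j * (1 - p) ^ (n - j)"
      by (simp add: mult.assoc mult_left_mono)
  qed
  also have "\<dots> \<le> (\<Sum>j\<le>n. real (n choose j) * p ^ j * (1 - p) ^ (n - j))"
    using p assms by (intro sum_mono2) auto
  also have "\<dots> = 1"
    using binomial_ring[of p "1 - p" n] by simp
  finally show ?thesis
    by (simp add: exp_minus field_simps p_def)
qed

lemma hb_nonneg:
  assumes "0 \<le> p" "p \<le> 1"
  shows "0 \<le> hb p"
proof (cases "p = 0 \<or> p = 1")
  case False
  then have "p * ln p \<le> 0" "(1 - p) * ln (1 - p) \<le> 0"
    using assms by (auto intro!: mult_nonneg_nonpos)
  then show ?thesis by (simp add: hb_def)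
qed (auto simp: hb_def)

definition schedules :: "nat set \<Rightarrow> (nat \<Rightarrow> 'c) \<Rightarrow> nat \<Rightarrow> (nat \<Rightarrow> 'b) set" where
  "schedules T C m =
    {\<sigma> \<in> T \<rightarrow>\<^sub>E UNIV. \<forall>c. nswitch (map \<sigma> (sorted_list_of_set {t \<in> T. C t = c})) \<le> m}"

text \<open>Bounds the logarithm of the number of schedules, per position, for \<open>C\<close> contexts, \<open>N\<close> rules and
  \<open>r\<close> positions.\<close>

definition schedule_rate :: "nat \<Rightarrow> nat \<Rightarrow> nat \<Rightarrow> nat \<Rightarrow> real" where
  "schedule_rate C N m r = real C * (hb (real m / real r) + real (m + 1) * ln (real N) / real r)"

lemma schedule_rate_ge:
  assumes "0 < C" "0 < N" "0 < r" "m \<le> r"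
  shows "real (m + 1) * ln (real N) / real r \<le> schedule_rate C N m r"
proof -
  have "0 \<le> hb (real m / real r)" using assms by (intro hb_nonneg) auto
  moreover have "0 \<le> ln (real N)" using assms by simp
  ultimately have "1 * (0 + real (m + 1) * ln (real N) / real r) \<le> schedule_rate C N m r"
    unfolding schedule_rate_def using assms by (intro mult_mono add_mono) auto
  then show ?thesis by simp
qed

lemma schedule_rate_nonneg: "\<lbrakk>0 < C; 0 < N; 0 < r; m \<le> r\<rbrakk> \<Longrightarrow> 0 \<le> schedule_rate C N m r"
  by (rule order_trans[OF _ schedule_rate_ge]) auto

lemma card_schedules_le_prod:
  fixes C :: "nat \<Rightarrow> 'c"
  assumes T: "finite T" and I: "finite I" "C ` T \<subseteq> I"
  shows "card (schedules T C m :: (nat \<Rightarrow> 'b::finite) set)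
    \<le> (\<Prod>c\<in>I. card (few_switch_words (card {t \<in> T. C t = c}) m :: 'b list set))"
proof -
  let ?V = "\<lambda>c. few_switch_words (card {t \<in> T. C t = c}) m :: 'b list set"
  define along where "along = (\<lambda>(\<sigma> :: nat \<Rightarrow> 'b) c. map \<sigma> (sorted_list_of_set {t \<in> T. C t = c}))"
  have "card (schedules T C m :: (nat \<Rightarrow> 'b) set) \<le> card (PiE I ?V)"
  proof (rule card_inj_on_le[where f = "\<lambda>\<sigma>. restrict (along \<sigma>) I"])
    show "inj_on (\<lambda>\<sigma>. restrict (along \<sigma>) I) (schedules T C m :: (nat \<Rightarrow> 'b) set)"
    proof (rule inj_onI)
      fix \<sigma> \<sigma>' :: "nat \<Rightarrow> 'b"
      assume \<sigma>: "\<sigma> \<in> schedules T C m" "\<sigma>' \<in> schedules T C m"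
        and eq: "restrict (along \<sigma>) I = restrict (along \<sigma>') I"
      show "\<sigma> = \<sigma>'"
      proof (rule PiE_ext)
        show "\<sigma> \<in> T \<rightarrow>\<^sub>E UNIV" "\<sigma>' \<in> T \<rightarrow>\<^sub>E UNIV" using \<sigma> by (auto simp: schedules_def)
        fix t assume t: "t \<in> T"
        then have "along \<sigma> (C t) = along \<sigma>' (C t)"
          using fun_cong[OF eq, of "C t"] I by (simp add: image_subset_iff)
        then show "\<sigma> t = \<sigma>' t" using t T by (simp add: along_def)
      qed
    qed
    show "(\<lambda>\<sigma>. restrict (along \<sigma>) I) ` schedules T C m \<subseteq> PiE I ?V"
      by (auto simp: along_def schedules_def few_switch_words_def)
    show "finite (PiE I ?V)"
      using I by (intro finite_PiE finite_few_switch_words)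
  qed
  then show ?thesis using I by (simp add: card_PiE)
qed

lemma card_schedules_le:
  fixes C :: "nat \<Rightarrow> 'c"
  assumes T: "finite T" "card T \<le> r" and I: "finite I" "C ` T \<subseteq> I"
    and r: "0 < r" "2 * m \<le> r"
  shows "real (card (schedules T C m :: (nat \<Rightarrow> 'b::finite) set))
    \<le> exp (real r * schedule_rate (card I) CARD('b) m r)"
proof -
  let ?V = "\<lambda>c. few_switch_words (card {t \<in> T. C t = c}) m :: 'b list set"
  let ?K = "real CARD('b) ^ (m + 1) * exp (real r * hb (real m / real r))"
  have card_V: "real (card (?V c)) \<le> ?K" for c
  proof -
    have "card {t \<in> T. C t = c} \<le> r"
      by (rule order_trans[OF card_mono T(2)]) (use T in auto)
    then have "(\<Sum>j\<le>m. card {t \<in> T. C t = c} choose j) \<le> (\<Sum>j\<le>m. r choose j)"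
      by (intro sum_mono binomial_right_mono)
    then have "card (?V c) \<le> CARD('b) ^ (m + 1) * (\<Sum>j\<le>m. r choose j)"
      by (rule order_trans[OF card_few_switch_words_le mult_left_mono]) simp
    then have "real (card (?V c)) \<le> real CARD('b) ^ (m + 1) * real (\<Sum>j\<le>m. r choose j)"
      by (simp only: of_nat_mult[symmetric] of_nat_power[symmetric] of_nat_le_iff)
    also have "\<dots> \<le> ?K"
      by (intro mult_left_mono sum_binomial_le_exp_hb r) simp
    finally show ?thesis .
  qed
  have exp_ln: "exp (real (m + 1) * ln (real CARD('b))) = real CARD('b) ^ (m + 1)"
    unfolding exp_of_nat_mult by simp
  have "real (card (schedules T C m :: (nat \<Rightarrow> 'b) set)) \<le> real (\<Prod>c\<in>I. card (?V c))"
    by (rule of_nat_mono[OF card_schedules_le_prod[OF T(1) I]])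
  also have "\<dots> = (\<Prod>c\<in>I. real (card (?V c)))" by (rule of_nat_prod)
  also have "\<dots> \<le> (\<Prod>c\<in>I. ?K)"
    by (intro prod_mono conjI card_V) simp
  also have "\<dots> = exp (real r * hb (real m / real r) + real (m + 1) * ln (real CARD('b))) ^ card I"
    by (simp only: exp_add exp_ln prod_constant mult.commute)
  also have "\<dots> = exp (real r * schedule_rate (card I) CARD('b) m r)"
  proof -
    have "real r * schedule_rate (card I) CARD('b) m r
        = real (card I) * (real r * hb (real m / real r) + real (m + 1) * ln (real CARD('b)))"
      using r unfolding schedule_rate_def by (simp add: distrib_left mult.left_commute)
    then show ?thesis by (simp only: exp_of_nat_mult)
  qed
  finally show ?thesis .
qed

subsection \<open>Stationary processes and products of blocks\<close>

lemma space_process: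
  assumes "is_process P"
  shows "space P = UNIV"
proof -
  have "space P = space seqM"
    using assms unfolding is_process_def by (intro sets_eq_imp_space_eq) simp
  then show ?thesis by (simp add: seqM_def space_PiM)
qed

lemma stationary_is_process: "is_stationary Q \<Longrightarrow> is_process Q"
  by (simp add: is_stationary_def)

lemma cylinder_sets:
  fixes n :: nat
  assumes "is_process P"
  shows "{\<omega>. \<forall>i<n. \<omega> (f i) = a i} \<in> sets P"
proof -
  have "sets P = sets seqM" using assms by (simp add: is_process_def)
  moreover have "(\<lambda>\<omega>. \<omega> j) \<in> measurable seqM (count_space UNIV)" for j
    unfolding seqM_def by (rule measurable_component_singleton) simp
  ultimately have "(\<lambda>\<omega>. \<omega> j) \<in> measurable P (count_space UNIV)" for j
    using measurable_cong_sets[OF _ refl] by blast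
  then have "(\<lambda>\<omega>. \<omega> j) -` {x} \<inter> space P \<in> sets P" for j x
    by (rule measurable_sets) simp
  then have "{\<omega> \<in> space P. \<omega> j = x} \<in> sets P" for j x
    by (simp add: vimage_def Int_def conj_commute)
  then have "{\<omega> \<in> space P. \<forall>i\<in>{..<n}. \<omega> (f i) = a i} \<in> sets P"
    by (intro sets.sets_Collect_finite_All) simp_all
  then show ?thesis
    by (simp add: space_process[OF assms] Ball_def)
qed

lemma pfx_eq: "is_process P \<Longrightarrow> pfx P xs = measure P {\<omega>. \<forall>i<length xs. \<omega> i = xs ! i}"
  by (simp add: pfx_def space_process)

lemma pfx_nonneg: "0 \<le> pfx P xs"
  by (simp add: pfx_def)

lemma pfx_Nil: "is_process P \<Longrightarrow> pfx P [] = 1"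
  by (simp add: pfx_def is_process_def prob_space.prob_space)

lemma sum_measure_coordinate:
  fixes P :: "(nat \<Rightarrow> 'x::finite) measure"
  assumes "is_process P" "E \<in> sets P"
  shows "(\<Sum>x\<in>UNIV. measure P (E \<inter> {\<omega>. \<omega> i = x})) = measure P E"
proof -
  interpret prob_space P using assms(1) by (simp add: is_process_def)
  have "{\<omega>. \<omega> i = x} \<in> sets P" for x
    using cylinder_sets[OF assms(1), of "Suc 0" "\<lambda>_. i" "\<lambda>_. x"] by simp
  then have "measure P (\<Union>x\<in>UNIV. E \<inter> {\<omega>. \<omega> i = x}) = (\<Sum>x\<in>UNIV. measure P (E \<inter> {\<omega>. \<omega> i = x}))"
    using assms(2) by (intro finite_measure_finite_Union) (auto simp: disjoint_family_on_def)
  moreover have "(\<Union>x\<in>UNIV. E \<inter> {\<omega>. \<omega> i = x}) = E" by auto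
  ultimately show ?thesis by simp
qed

lemma sum_pfx_snoc:
  fixes P :: "(nat \<Rightarrow> 'x::finite) measure"
  assumes "is_process P"
  shows "(\<Sum>x\<in>UNIV. pfx P (xs @ [x])) = pfx P xs"
proof -
  have "{\<omega>. \<forall>i<length (xs @ [x]). \<omega> i = (xs @ [x]) ! i}
    = {\<omega>. \<forall>i<length xs. \<omega> i = xs ! i} \<inter> {\<omega>. \<omega> (length xs) = x}" for x
    by (auto simp: nth_append less_Suc_eq)
  then show ?thesis
    unfolding pfx_eq[OF assms]
    by (simp only: sum_measure_coordinate[OF assms cylinder_sets[OF assms]])
qed

lemma measure_shifted_prefix:
  assumes "is_stationary Q"
  shows "measure Q {\<omega>. \<forall>i<length xs. \<omega> (Suc i) = xs ! i} = pfx Q xs"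
proof -
  have Q: "is_process Q" by (rule stationary_is_process[OF assms])
  have sets: "sets Q = sets seqM" using Q by (simp add: is_process_def)
  have "(\<lambda>\<omega> i. \<omega> (Suc i)) \<in> measurable seqM seqM"
    unfolding seqM_def
    by (rule measurable_PiM_single') (auto simp: space_PiM intro!: measurable_component_singleton)
  then have shift: "(\<lambda>\<omega> i. \<omega> (Suc i)) \<in> measurable Q seqM"
    using measurable_cong_sets[OF sets refl] by blast
  have "pfx Q xs = measure (distr Q seqM (\<lambda>\<omega> i. \<omega> (Suc i))) {\<omega>. \<forall>i<length xs. \<omega> i = xs ! i}"
    using assms by (simp add: is_stationary_def pfx_eq[OF Q])
  also have "\<dots> = measure Q {\<omega>. \<forall>i<length xs. \<omega> (Suc i) = xs ! i}"
    using cylinder_sets[OF Q, of "length xs" "\<lambda>i. i" "(!) xs"]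
    by (subst measure_distr[OF shift]) (simp_all add: sets vimage_def space_process[OF Q])
  finally show ?thesis by simp
qed

lemma sum_pfx_Cons:
  fixes Q :: "(nat \<Rightarrow> 'x::finite) measure"
  assumes "is_stationary Q"
  shows "(\<Sum>x\<in>UNIV. pfx Q (x # xs)) = pfx Q xs"
proof -
  have Q: "is_process Q" by (rule stationary_is_process[OF assms])
  have "{\<omega>. \<forall>i<length (x # xs). \<omega> i = (x # xs) ! i}
    = {\<omega>. \<forall>i<length xs. \<omega> (Suc i) = xs ! i} \<inter> {\<omega>. \<omega> 0 = x}" for x
    by (auto simp: less_Suc_eq_0_disj)
  then show ?thesis
    unfolding pfx_eq[OF Q, of "_ # _"]
    by (simp only: sum_measure_coordinate[OF Q cylinder_sets[OF Q]]
        measure_shifted_prefix[OF assms])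
qed

lemma sum_pfx_suffix:
  fixes P :: "(nat \<Rightarrow> 'x::finite) measure"
  assumes "is_process P"
  shows "(\<Sum>w\<in>words b. pfx P (v @ w)) = pfx P v"
proof (induction b arbitrary: v)
  case (Suc b)
  have "(\<Sum>w\<in>words (Suc b). pfx P (v @ w)) = (\<Sum>x\<in>UNIV. \<Sum>w\<in>words b. pfx P ((v @ [x]) @ w))"
    by (simp add: sum_words_Suc)
  then show ?case by (simp only: Suc.IH sum_pfx_snoc[OF assms])
qed simp

lemma sum_pfx_prefix:
  fixes Q :: "(nat \<Rightarrow> 'x::finite) measure"
  assumes "is_stationary Q"
  shows "(\<Sum>u\<in>words a. pfx Q (u @ v)) = pfx Q v"
proof (induction a)
  case (Suc a)
  have "(\<Sum>u\<in>words (Suc a). pfx Q (u @ v)) = (\<Sum>u\<in>words a. \<Sum>x\<in>UNIV. pfx Q (x # u @ v))"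
    unfolding sum_words_Suc by (subst sum.swap) simp
  then show ?case using Suc by (simp add: sum_pfx_Cons[OF assms])
qed simp

lemma sum_pfx_window:
  fixes Q :: "(nat \<Rightarrow> 'x::finite) measure"
  assumes "is_stationary Q"
  shows "(\<Sum>u\<in>words a. \<Sum>w\<in>words b. pfx Q (u @ v @ w)) = pfx Q v"
  using sum_pfx_suffix[OF stationary_is_process[OF assms], of "_ @ v" b]
  by (simp add: sum_pfx_prefix[OF assms])

definition word_distribution :: "nat \<Rightarrow> ('x list \<Rightarrow> real) \<Rightarrow> bool" where
  "word_distribution n W \<longleftrightarrow> (\<forall>xs. 0 \<le> W xs) \<and> (\<Sum>xs\<in>words n. W xs) = 1"

lemma word_distribution_pfx:
  fixes P :: "(nat \<Rightarrow> 'x::finite) measure"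
  shows "is_process P \<Longrightarrow> word_distribution n (pfx P)"
  using sum_pfx_suffix[of P "[]" n] by (simp add: word_distribution_def pfx_nonneg pfx_Nil)

lemma block_ends_replicate:
  assumes "0 < l"
  shows "block_ends (replicate l a) = [l]"
proof -
  have "{t. 0 < t \<and> t \<le> l \<and> (t = l \<or> replicate l a ! (t - 1) \<noteq> replicate l a ! t)} = {l}"
    using assms by (auto simp: le_less)
  then show ?thesis by (simp add: block_ends_def)
qed

lemma set_block_ends:
  "set (block_ends as) = {t. 0 < t \<and> t \<le> length as \<and> (t = length as \<or> as ! (t - 1) \<noteq> as ! t)}"
  unfolding block_ends_def by (rule set_sorted_list_of_set) simp

lemma sorted_block_ends: "sorted (block_ends as)"
  and distinct_block_ends: "distinct (block_ends as)"
  by (simp_all add: block_ends_def)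

lemma last_block_ends: "last (0 # block_ends as) = length as"
proof (cases "as = []")
  case False
  then have mem: "length as \<in> set (block_ends as)" by (simp add: set_block_ends)
  then have ne: "block_ends as \<noteq> []" by auto
  then have "last (block_ends as) \<le> length as"
    using last_in_set[OF ne] by (simp add: set_block_ends)
  moreover have "length as \<le> last (block_ends as)"
  proof -
    obtain i where i: "i < length (block_ends as)" "block_ends as ! i = length as"
      using mem by (auto simp: in_set_conv_nth)
    then show ?thesis
      using sorted_nth_mono[OF sorted_block_ends, of i "length (block_ends as) - 1" as]
      by (simp add: last_conv_nth[OF ne])
  qed
  ultimately show ?thesis using ne by simp
qed (simp add: block_ends_def)

lemma block_ends_append:
  assumes "as = [] \<or> bs = [] \<or> last as \<noteq> hd bs"
  shows "block_ends (as @ bs) = block_ends as @ map ((+) (length as)) (block_ends bs)"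
proof (rule sorted_distinct_set_unique)
  show "set (block_ends (as @ bs)) = set (block_ends as @ map ((+) (length as)) (block_ends bs))"
  proof (rule set_eqI)
    fix t
    consider (left) "t < length as" | (seam) "t = length as"
      | (right) s where "t = length as + s" "0 < s"
      by (metis less_imp_add_positive linorder_neqE_nat)
    then show "t \<in> set (block_ends (as @ bs)) \<longleftrightarrow>
      t \<in> set (block_ends as @ map ((+) (length as)) (block_ends bs))"
    proof cases
      case left
      then show ?thesis by (auto simp: set_block_ends nth_append)
    next
      case seam
      then show ?thesis
        using assms by (auto simp: set_block_ends nth_append last_conv_nth hd_conv_nth)
    next
      case right
      then show ?thesis by (auto simp: set_block_ends nth_append image_iff)
    qed
  qed
  show "sorted (block_ends as @ map ((+) (length as)) (block_ends bs))"
    using sorted_block_ends[of as] sorted_block_ends[of bs]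
    by (auto simp: sorted_append sorted_map set_block_ends intro: sorted_wrt_mono_rel)
  show "distinct (block_ends as @ map ((+) (length as)) (block_ends bs))"
    using distinct_block_ends[of as] distinct_block_ends[of bs]
    by (auto simp: distinct_map inj_on_def set_block_ends)
qed (rule sorted_block_ends distinct_block_ends)+

lemma nth_Cons_block_ends_append:
  assumes "j < length es"
  shows "(0 # block_ends as @ map ((+) (length as)) es) ! (length (block_ends as) + j)
    = length as + (0 # es) ! j"
proof (cases j)
  case 0
  have "(0 # block_ends as @ map ((+) (length as)) es) ! length (block_ends as)
    = last (0 # block_ends as)"
    by (simp add: nth_Cons' nth_append last_conv_nth)
  then show ?thesis using 0 by (simp only: last_block_ends add_0_right nth_Cons_0)
next
  case (Suc j')
  then show ?thesis using assms by (simp add: nth_append)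
qed

lemma block_prod_append:
  assumes "as = [] \<or> bs = [] \<or> last as \<noteq> hd bs" and u: "length u = length as"
  shows "block_prod Q (as @ bs) (u @ v) = block_prod Q as u * block_prod Q bs v"
proof -
  let ?\<tau> = "block_ends as" and ?\<upsilon> = "block_ends bs" and ?n = "length as"
  let ?\<theta> = "?\<tau> @ map ((+) ?n) ?\<upsilon>"
  let ?factor = "\<lambda>cs \<theta> xs i.
    pfx (Q (cs ! (\<theta> ! i - 1))) (take (\<theta> ! i - (0 # \<theta>) ! i) (drop ((0 # \<theta>) ! i) xs))"
  have split: "(\<Prod>i<a + b. g i) = (\<Prod>i<a. g i) * (\<Prod>j<b. g (a + j))" for a b and g :: "nat \<Rightarrow> real"
    by (induction b) (simp_all add: mult.assoc)
  have factor_left: "?factor (as @ bs) ?\<theta> (u @ v) i = ?factor as ?\<tau> u i" if i: "i < length ?\<tau>" for i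
  proof -
    have "?\<tau> ! i \<le> ?n" "?\<tau> ! i - 1 < ?n"
      using nth_mem[OF i] by (auto simp: set_block_ends)
    moreover have "(0 # ?\<theta>) ! i = (0 # ?\<tau>) ! i"
      using i by (cases i) (auto simp: nth_append)
    ultimately show ?thesis using i u by (simp add: nth_append)
  qed
  have factor_right: "?factor (as @ bs) ?\<theta> (u @ v) (length ?\<tau> + j) = ?factor bs ?\<upsilon> v j"
    if j: "j < length ?\<upsilon>" for j
  proof -
    have "?n + ?\<upsilon> ! j - 1 = ?n + (?\<upsilon> ! j - 1)"
      using nth_mem[OF j] by (auto simp: set_block_ends)
    then show ?thesis
      using j u nth_Cons_block_ends_append[OF j, of as] by (simp add: nth_append)
  qed
  have "block_prod Q (as @ bs) (u @ v) = (\<Prod>i<length ?\<tau> + length ?\<upsilon>. ?factor (as @ bs) ?\<theta> (u @ v) i)"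
    by (simp only: block_prod_def block_ends_append[OF assms(1)] Let_def length_append length_map)
  also have "\<dots> = (\<Prod>i<length ?\<tau>. ?factor as ?\<tau> u i) * (\<Prod>j<length ?\<upsilon>. ?factor bs ?\<upsilon> v j)"
    unfolding split
    by (intro arg_cong2[where f = "(*)"] prod.cong refl)
      (simp_all only: factor_left factor_right lessThan_iff)
  finally show ?thesis by (simp only: block_prod_def Let_def)
qed

lemma block_prod_replicate:
  "\<lbrakk>0 < l; length v = l\<rbrakk> \<Longrightarrow> block_prod Q (replicate l a) v = pfx (Q a) v"
  by (simp add: block_prod_def block_ends_replicate)

lemma block_prod_Nil [simp]: "block_prod Q [] xs = 1"
proof -
  have "set (block_ends ([] :: nat list)) = {}" by (auto simp: set_block_ends)
  then show ?thesis by (simp add: block_prod_def)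
qed

lemma block_prod_nonneg: "0 \<le> block_prod Q as xs"
  unfolding block_prod_def Let_def by (intro prod_nonneg ballI pfx_nonneg)

definition maximal_run :: "'a list \<Rightarrow> nat \<Rightarrow> 'a \<Rightarrow> 'a list \<Rightarrow> bool" where
  "maximal_run as l a bs \<longleftrightarrow> 0 < l \<and> (as = [] \<or> last as \<noteq> a) \<and> (bs = [] \<or> hd bs \<noteq> a)"

lemma maximal_run_at:
  assumes "t < length cs"
  obtains as l bs where "cs = as @ replicate l (cs ! t) @ bs" "maximal_run as l (cs ! t) bs"
    "length as \<le> t" "t < length as + l"
proof -
  let ?a = "cs ! t"
  let ?before = "rev (take t cs)" and ?after = "drop t cs"
  define as where "as = rev (dropWhile (\<lambda>x. x = ?a) ?before)"
  define bs where "bs = dropWhile (\<lambda>x. x = ?a) ?after"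
  have run: "\<exists>i. takeWhile (\<lambda>x. x = ?a) xs = replicate i ?a" for xs
    by (rule exI, rule replicate_length_same[symmetric]) (auto dest: set_takeWhileD)
  obtain i where "takeWhile (\<lambda>x. x = ?a) ?before = replicate i ?a" using run by blast
  then have "?before = replicate i ?a @ rev as"
    using takeWhile_dropWhile_id[of "\<lambda>x. x = ?a" ?before] by (simp add: as_def)
  then have "rev ?before = rev (replicate i ?a @ rev as)" by (rule arg_cong)
  then have before: "take t cs = as @ replicate i ?a" by simp
  obtain j where "takeWhile (\<lambda>x. x = ?a) ?after = replicate j ?a" using run by blast
  moreover have "takeWhile (\<lambda>x. x = ?a) ?after \<noteq> []"
    by (simp flip: Cons_nth_drop_Suc[OF assms])
  ultimately have after: "drop t cs = replicate j ?a @ bs" and "0 < j"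
    using takeWhile_dropWhile_id[of "\<lambda>x. x = ?a" ?after] by (auto simp: bs_def)
  show ?thesis
  proof (rule that)
    show "cs = as @ replicate (i + j) ?a @ bs"
      using append_take_drop_id[of t cs] unfolding before after by (simp add: replicate_add)
    show "maximal_run as (i + j) ?a bs"
      using \<open>0 < j\<close> hd_dropWhile[of "\<lambda>x. x = ?a" ?before] hd_dropWhile[of "\<lambda>x. x = ?a" ?after]
      by (auto simp: maximal_run_def as_def bs_def last_rev)
    have "t = length as + i" using arg_cong[OF before, of length] assms by simp
    then show "length as \<le> t" "t < length as + (i + j)" using \<open>0 < j\<close> by simp_all
  qed
qed

lemma window_within_run:
  assumes as: "as = us @ replicate l a @ vs" and run: "maximal_run us l a vs"
    and t: "t \<notin> near_switch k as" "k \<le> t" "t + k < length as"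
    and in_run: "length us \<le> t" "t < length us + l"
  shows "length us + k \<le> t" "t + k < length us + l"
proof -
  have len: "length as = length us + (l + length vs)" by (simp add: as)
  have equal: "as ! j = as ! Suc j" if "t \<le> j + k" "j < t + k" for j
    using that t unfolding near_switch_def by auto
  show "length us + k \<le> t"
  proof (rule ccontr)
    assume less: "\<not> length us + k \<le> t"
    then have us: "us \<noteq> []" using t(2) by auto
    then have "as ! (length us - 1) = as ! Suc (length us - 1)"
      using less in_run by (intro equal) auto
    then have "last us = a"
      using us in_run by (simp add: as nth_append last_conv_nth)
    then show False using run us by (simp add: maximal_run_def)
  qed
  show "t + k < length us + l"
  proof (rule ccontr)
    assume ge: "\<not> t + k < length us + l"
    then have vs: "vs \<noteq> []" using t(3) len by auto
    obtain l' where l: "l = Suc l'" using run by (cases l) (auto simp: maximal_run_def)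
    then have "as ! (length us + l') = as ! Suc (length us + l')"
      using ge in_run by (intro equal) auto
    then have "hd vs = a"
      using vs by (simp add: as l nth_append hd_conv_nth del: replicate_Suc)
    then show False using run vs by (simp add: maximal_run_def)
  qed
qed

lemma block_prod_maximal_run:
  assumes "maximal_run as l a bs" "length u = length as" "length v = l"
  shows "block_prod Q (as @ replicate l a @ bs) (u @ v @ w)
    = block_prod Q as u * (pfx (Q a) v * block_prod Q bs w)"
proof -
  have l: "0 < l" "replicate l a \<noteq> []" "last (replicate l a) = a" "hd (replicate l a @ bs) = a"
    using assms(1) by (simp_all add: maximal_run_def hd_append)
  have "block_prod Q (as @ replicate l a @ bs) (u @ v @ w)
    = block_prod Q as u * block_prod Q (replicate l a @ bs) (v @ w)"
    by (rule block_prod_append) (use assms l in \<open>auto simp: maximal_run_def\<close>)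
  also have "block_prod Q (replicate l a @ bs) (v @ w)
    = block_prod Q (replicate l a) v * block_prod Q bs w"
    by (rule block_prod_append) (use assms l in \<open>auto simp: maximal_run_def\<close>)
  finally show ?thesis using assms(3) l(1) by (simp add: block_prod_replicate)
qed

lemma word_distribution_block_prod:
  fixes Q :: "nat \<Rightarrow> (nat \<Rightarrow> 'x::finite) measure"
  assumes "\<And>a. a \<in> set as \<Longrightarrow> is_process (Q a)"
  shows "word_distribution (length as) (block_prod Q as)"
proof -
  have "(\<Sum>xs\<in>words (length as). block_prod Q as xs) = 1"
    using assms
  proof (induction as rule: length_induct)
    case (1 cs)
    show ?case
    proof (cases "cs = []")
      case False
      then obtain as l bs where "cs = as @ replicate l (cs ! 0) @ bs" "maximal_run as l (cs ! 0) bs"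
        "length as \<le> 0"
        using maximal_run_at[of 0 cs] by blast
      then have cs: "cs = replicate l (cs ! 0) @ bs" and run: "maximal_run [] l (cs ! 0) bs"
        by simp_all
      let ?q = "Q (cs ! 0)"
      have q: "is_process ?q" using 1 False by simp
      have len: "length cs = l + length bs" using arg_cong[OF cs, of length] by simp
      have "0 < l" using run by (simp add: maximal_run_def)
      have "set bs \<subseteq> set cs" using arg_cong[OF cs, of set] by auto
      then have IH: "(\<Sum>w\<in>words (length bs). block_prod Q bs w) = 1"
        using 1 len \<open>0 < l\<close> by (simp add: subset_iff)
      have "(\<Sum>xs\<in>words (length cs). block_prod Q cs xs)
        = (\<Sum>v\<in>words l. \<Sum>w\<in>words (length bs). pfx ?q v * block_prod Q bs w)"
        unfolding len sum_words_append
        by (intro sum.cong refl, subst cs) (use block_prod_maximal_run[OF run, of "[]"] in simp)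
      also have "\<dots> = (\<Sum>v\<in>words l. pfx ?q v)"
        by (simp add: IH flip: sum_distrib_left)
      also have "\<dots> = 1" using word_distribution_pfx[OF q] by (simp add: word_distribution_def)
      finally show ?thesis .
    qed simp
  qed
  then show ?thesis by (simp add: word_distribution_def block_prod_nonneg)
qed

lemma sum_block_prod_outside_run:
  fixes Q :: "nat \<Rightarrow> (nat \<Rightarrow> 'x::finite) measure"
  assumes run: "maximal_run as l a bs" and v: "length v = l"
    and Q: "\<And>x. x \<in> set as \<union> set bs \<Longrightarrow> is_process (Q x)"
  shows "(\<Sum>u\<in>words (length as). \<Sum>w\<in>words (length bs).
      block_prod Q (as @ replicate l a @ bs) (u @ v @ w)) = pfx (Q a) v"
proof -
  have "(\<Sum>u\<in>words (length as). \<Sum>w\<in>words (length bs).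
      block_prod Q (as @ replicate l a @ bs) (u @ v @ w))
    = (\<Sum>u\<in>words (length as). \<Sum>w\<in>words (length bs).
        block_prod Q as u * (pfx (Q a) v * block_prod Q bs w))"
    by (intro sum.cong refl block_prod_maximal_run[OF run _ v]) simp
  also have "\<dots> = pfx (Q a) v"
    using word_distribution_block_prod[of as Q] word_distribution_block_prod[of bs Q] Q
    by (simp add: word_distribution_def flip: sum_distrib_left sum_distrib_right)
  finally show ?thesis .
qed

subsection \<open>Bayes risk\<close>

locale denoising = memoryless_channel Ch
  for Ch :: "'x::finite \<Rightarrow> 'z::finite \<Rightarrow> real" +
  fixes \<Lambda> :: "'x \<Rightarrow> 'xh::finite \<Rightarrow> real"
  assumes loss_nonneg: "0 \<le> \<Lambda> x y"
begin

lemma loss_le_Lambda_max: "\<Lambda> x y \<le> Lambda_max \<Lambda>"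
  unfolding Lambda_max_def by (rule Max_ge) auto

lemma Lambda_max_nonneg: "0 \<le> Lambda_max \<Lambda>"
  using loss_nonneg loss_le_Lambda_max order_trans by blast

definition mean_loss :: "nat \<Rightarrow> ('x list \<Rightarrow> real) \<Rightarrow> ('z list \<Rightarrow> 'xh) \<Rightarrow> nat \<Rightarrow> real" where
  "mean_loss n W d i = (\<Sum>xs\<in>words n. W xs * \<E> xs (\<lambda>zs. \<Lambda> (xs ! i) (d zs)))"

definition bayes_risk :: "nat \<Rightarrow> ('x list \<Rightarrow> real) \<Rightarrow> nat \<Rightarrow> real" where
  "bayes_risk n W i = (INF d. mean_loss n W d i)"

definition bayes_rule :: "nat \<Rightarrow> ('x list \<Rightarrow> real) \<Rightarrow> nat \<Rightarrow> 'z list \<Rightarrow> 'xh" where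
  "bayes_rule n W i = (SOME d. mean_loss n W d i = bayes_risk n W i)"

lemma mean_loss_cong:
  "(\<And>zs. length zs = n \<Longrightarrow> d zs = d' zs) \<Longrightarrow> mean_loss n W d i = mean_loss n W d' i"
  unfolding mean_loss_def
  by (intro sum.cong refl arg_cong2[where f = "(*)"] channel_mean_cong) simp

lemma mean_loss_nonneg: "word_distribution n W \<Longrightarrow> 0 \<le> mean_loss n W d i"
  unfolding mean_loss_def word_distribution_def
  by (intro sum_nonneg mult_nonneg_nonneg channel_mean_nonneg loss_nonneg) simp

lemma mean_loss_le_Lambda_max:
  assumes "word_distribution n W"
  shows "mean_loss n W d i \<le> Lambda_max \<Lambda>"
proof -
  have "mean_loss n W d i \<le> (\<Sum>xs\<in>words n. W xs * \<E> xs (\<lambda>zs. Lambda_max \<Lambda>))"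
    unfolding mean_loss_def using assms
    by (intro sum_mono mult_left_mono channel_mean_mono loss_le_Lambda_max)
      (simp add: word_distribution_def)
  then show ?thesis
    using assms by (simp add: word_distribution_def flip: sum_distrib_right)
qed

lemma sum_mean_loss:
  "(\<Sum>t\<in>I. mean_loss n W (\<lambda>zs. D zs t) t)
    = (\<Sum>xs\<in>words n. W xs * \<E> xs (\<lambda>zs. \<Sum>t\<in>I. \<Lambda> (xs ! t) (D zs t)))"
  unfolding mean_loss_def channel_mean_sum sum_distrib_left by (rule sum.swap)

lemma finite_range_mean_loss: "finite (range (\<lambda>d. mean_loss n W d i))"
proof (rule finite_subset)
  show "range (\<lambda>d. mean_loss n W d i) \<subseteq> (\<lambda>d. mean_loss n W d i) ` (words n \<rightarrow>\<^sub>E UNIV)"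
  proof (rule image_subsetI)
    fix d
    have "mean_loss n W d i = mean_loss n W (restrict d (words n)) i"
      by (rule mean_loss_cong) simp
    then show "mean_loss n W d i \<in> (\<lambda>d. mean_loss n W d i) ` (words n \<rightarrow>\<^sub>E UNIV)"
      by (intro image_eqI[where x = "restrict d (words n)"]) simp_all
  qed
qed (intro finite_imageI finite_PiE finite_words finite)

lemma bayes_risk_le: "bayes_risk n W i \<le> mean_loss n W d i"
  unfolding bayes_risk_def by (intro cINF_lower bdd_below_finite finite_range_mean_loss) simp

lemma mean_loss_bayes_rule: "mean_loss n W (bayes_rule n W i) i = bayes_risk n W i"
proof -
  have "bayes_risk n W i = Min (range (\<lambda>d. mean_loss n W d i))"
    unfolding bayes_risk_def by (intro cInf_eq_Min finite_range_mean_loss) simp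
  then have "bayes_risk n W i \<in> range (\<lambda>d. mean_loss n W d i)"
    using Min_in[OF finite_range_mean_loss] by simp
  then have "\<exists>d. mean_loss n W d i = bayes_risk n W i" by (metis imageE)
  then show ?thesis unfolding bayes_rule_def by (rule someI_ex)
qed

lemma bayes_risk_nonneg: "word_distribution n W \<Longrightarrow> 0 \<le> bayes_risk n W i"
  using mean_loss_nonneg mean_loss_bayes_rule by metis

lemma mean_loss_window:
  assumes margin: "\<And>v. length v = n \<Longrightarrow> (\<Sum>u\<in>words a. \<Sum>w\<in>words b. W (u @ v @ w)) = V v" and i: "i < n"
  shows "mean_loss (a + (n + b)) W (\<lambda>zs. d (take n (drop a zs))) (a + i) = mean_loss n V d i"
proof -
  let ?g = "\<lambda>v. \<E> v (\<lambda>zv. \<Lambda> (v ! i) (d zv))"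
  have "mean_loss (a + (n + b)) W (\<lambda>zs. d (take n (drop a zs))) (a + i)
    = (\<Sum>u\<in>words a. \<Sum>v\<in>words n. \<Sum>w\<in>words b. W (u @ v @ w) * ?g v)"
    unfolding mean_loss_def sum_words_append
  proof (intro sum.cong refl)
    fix u v w :: "'x list" assume "u \<in> words a" "v \<in> words n" "w \<in> words b"
    then have "\<E> (u @ v @ w) (\<lambda>zs. \<Lambda> ((u @ v @ w) ! (a + i)) (d (take n (drop a zs)))) = ?g v"
      using i channel_mean_window[of u a v n w "\<lambda>zv. \<Lambda> (v ! i) (d zv)"] by (simp add: nth_append)
    then show "W (u @ v @ w)
        * \<E> (u @ v @ w) (\<lambda>zs. \<Lambda> ((u @ v @ w) ! (a + i)) (d (take n (drop a zs))))
      = W (u @ v @ w) * ?g v" by simp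
  qed
  also have "\<dots> = (\<Sum>v\<in>words n. (\<Sum>u\<in>words a. \<Sum>w\<in>words b. W (u @ v @ w)) * ?g v)"
    unfolding sum_distrib_right by (rule sum.swap)
  also have "\<dots> = mean_loss n V d i"
    unfolding mean_loss_def by (intro sum.cong refl) (simp add: margin)
  finally show ?thesis .
qed

lemma mean_loss_independent_block:
  assumes W: "\<And>u v w. \<lbrakk>length u = a; length v = n; length w = b\<rbrakk>
      \<Longrightarrow> W (u @ v @ w) = F u * (V v * G w)"
    and i: "i < n"
  shows "mean_loss (a + (n + b)) W d (a + i)
    = (\<Sum>u\<in>words a. F u * (\<Sum>w\<in>words b. G w *
        \<E> u (\<lambda>zu. \<E> w (\<lambda>zw. mean_loss n V (\<lambda>zv. d (zu @ zv @ zw)) i))))"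
proof -
  let ?g = "\<lambda>u v w. \<E> u (\<lambda>zu. \<E> v (\<lambda>zv. \<E> w (\<lambda>zw. \<Lambda> (v ! i) (d (zu @ zv @ zw)))))"
  have expand: "\<E> u (\<lambda>zu. \<E> w (\<lambda>zw. mean_loss n V (\<lambda>zv. d (zu @ zv @ zw)) i))
      = (\<Sum>v\<in>words n. V v * ?g u v w)" for u w
    unfolding mean_loss_def
    by (simp only: channel_mean_sum channel_mean_cmult channel_mean_swap[of Ch w])
  have "mean_loss (a + (n + b)) W d (a + i)
    = (\<Sum>u\<in>words a. \<Sum>v\<in>words n. \<Sum>w\<in>words b. F u * (G w * (V v * ?g u v w)))"
    unfolding mean_loss_def sum_words_append
  proof (intro sum.cong refl)
    fix u v w :: "'x list" assume "u \<in> words a" "v \<in> words n" "w \<in> words b"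
    then show "W (u @ v @ w) * \<E> (u @ v @ w) (\<lambda>zs. \<Lambda> ((u @ v @ w) ! (a + i)) (d zs))
      = F u * (G w * (V v * ?g u v w))"
      using W i by (simp add: channel_mean_append nth_append mult_ac)
  qed
  also have "\<dots> = (\<Sum>u\<in>words a. \<Sum>w\<in>words b. \<Sum>v\<in>words n. F u * (G w * (V v * ?g u v w)))"
    by (intro sum.cong refl sum.swap)
  finally show ?thesis by (simp only: expand sum_distrib_left)
qed

lemma bayes_risk_le_independent_block:
  assumes F: "word_distribution a F" and G: "word_distribution b G"
    and W: "\<And>u v w. \<lbrakk>length u = a; length v = n; length w = b\<rbrakk>
      \<Longrightarrow> W (u @ v @ w) = F u * (V v * G w)"
    and i: "i < n"
  shows "bayes_risk n V i \<le> mean_loss (a + (n + b)) W d (a + i)"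
proof -
  have "bayes_risk n V i
    = (\<Sum>u\<in>words a. F u * (\<Sum>w\<in>words b. G w * \<E> u (\<lambda>zu. \<E> w (\<lambda>zw. bayes_risk n V i))))"
    using F G by (simp add: word_distribution_def flip: sum_distrib_right)
  also have "\<dots> \<le> (\<Sum>u\<in>words a. F u * (\<Sum>w\<in>words b. G w *
      \<E> u (\<lambda>zu. \<E> w (\<lambda>zw. mean_loss n V (\<lambda>zv. d (zu @ zv @ zw)) i))))"
    using F G
    by (intro sum_mono mult_left_mono channel_mean_mono bayes_risk_le)
      (auto simp: word_distribution_def)
  also have "\<dots> = mean_loss (a + (n + b)) W d (a + i)"
    by (rule mean_loss_independent_block[symmetric]) (simp_all add: W i)
  finally show ?thesis .
qed

lemma bayes_risk_antimono:
  assumes "is_stationary q" "i < n"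
  shows "bayes_risk (a + (n + b)) (pfx q) (a + i) \<le> bayes_risk n (pfx q) i"
proof -
  let ?d = "bayes_rule n (pfx q) i"
  have "bayes_risk (a + (n + b)) (pfx q) (a + i)
    \<le> mean_loss (a + (n + b)) (pfx q) (\<lambda>zs. ?d (take n (drop a zs))) (a + i)"
    by (rule bayes_risk_le)
  also have "\<dots> = mean_loss n (pfx q) ?d i"
    using assms by (intro mean_loss_window) (simp_all add: sum_pfx_window)
  finally show ?thesis by (simp only: mean_loss_bayes_rule)
qed

definition window_risk :: "(nat \<Rightarrow> 'x) measure \<Rightarrow> nat \<Rightarrow> real" where
  "window_risk q k = bayes_risk (2 * k + 1) (pfx q) k"

definition limit_risk :: "(nat \<Rightarrow> 'x) measure \<Rightarrow> real" where
  "limit_risk q = (INF k. window_risk q k)"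

lemma window_risk_nonneg: "is_process q \<Longrightarrow> 0 \<le> window_risk q k"
  unfolding window_risk_def by (intro bayes_risk_nonneg word_distribution_pfx)

lemma bdd_below_window_risk: "is_process q \<Longrightarrow> bdd_below (range (window_risk q))"
  by (rule bdd_belowI2) (rule window_risk_nonneg)

lemma limit_risk_nonneg: "is_process q \<Longrightarrow> 0 \<le> limit_risk q"
  unfolding limit_risk_def by (rule cINF_greatest) (simp_all add: window_risk_nonneg)

lemma limit_risk_le_window_risk: "is_process q \<Longrightarrow> limit_risk q \<le> window_risk q k"
  unfolding limit_risk_def by (rule cINF_lower[OF bdd_below_window_risk]) simp_all

lemma limit_risk_le_bayes_risk:
  assumes q: "is_stationary q" and i: "i < n"
  shows "limit_risk q \<le> bayes_risk n (pfx q) i"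
proof -
  define j where "j = n - 1 - i"
  define k where "k = max i j"
  have k: "(k - i) + (n + (k - j)) = 2 * k + 1" "(k - i) + i = k"
    using i by (auto simp: k_def j_def)
  have "limit_risk q \<le> window_risk q k"
    by (intro limit_risk_le_window_risk stationary_is_process q)
  also have "\<dots> \<le> bayes_risk n (pfx q) i"
    using bayes_risk_antimono[OF q i, of "k - i" "k - j"] unfolding k window_risk_def .
  finally show ?thesis .
qed

lemma window_risk_tendsto:
  assumes q: "is_stationary q"
  shows "window_risk q \<longlonglongrightarrow> limit_risk q"
  unfolding limit_risk_def
proof (rule LIMSEQ_decseq_INF[OF bdd_below_window_risk])
  show "is_process q" by (rule stationary_is_process[OF q])
  show "decseq (window_risk q)"
  proof (rule decseq_SucI)
    fix k
    have "1 + ((2 * k + 1) + 1) = 2 * Suc k + 1" "1 + k = Suc k" by auto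
    then show "window_risk q (Suc k) \<le> window_risk q k"
      using bayes_risk_antimono[OF q, of k "2 * k + 1" 1 1] unfolding window_risk_def by simp
  qed
qed

abbreviation regime_loss ::
    "(nat \<Rightarrow> (nat \<Rightarrow> 'x) measure) \<Rightarrow> nat list \<Rightarrow> ('z list \<Rightarrow> nat \<Rightarrow> 'xh) \<Rightarrow> nat \<Rightarrow> real" where
  "regime_loss Q as D t \<equiv> mean_loss (length as) (block_prod Q as) (\<lambda>zs. D zs t) t"

lemma limit_risk_le_regime_loss:
  assumes t: "t < length as" and Q: "\<And>a. a \<in> set as \<Longrightarrow> is_stationary (Q a)"
  shows "limit_risk (Q (as ! t)) \<le> regime_loss Q as D t"
proof -
  obtain us l vs where as: "as = us @ replicate l (as ! t) @ vs"
    and run: "maximal_run us l (as ! t) vs" and in_run: "length us \<le> t" "t < length us + l"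
    using maximal_run_at[OF t] by blast
  have n: "length as = length us + (l + length vs)" and set_as: "set us \<subseteq> set as" "set vs \<subseteq> set as"
    using arg_cong[OF as, of length] arg_cong[OF as, of set] by auto
  have "limit_risk (Q (as ! t)) \<le> bayes_risk l (pfx (Q (as ! t))) (t - length us)"
    using Q t in_run by (intro limit_risk_le_bayes_risk) auto
  also have "\<dots> \<le> mean_loss (length us + (l + length vs)) (block_prod Q as) (\<lambda>zs. D zs t)
      (length us + (t - length us))"
  proof (rule bayes_risk_le_independent_block
      [OF word_distribution_block_prod word_distribution_block_prod])
    fix u v w :: "'x list" assume "length u = length us" "length v = l" "length w = length vs"
    then show "block_prod Q as (u @ v @ w)
      = block_prod Q us u * (pfx (Q (as ! t)) v * block_prod Q vs w)"
      by (subst as) (rule block_prod_maximal_run[OF run])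
  qed (use in_run set_as Q in \<open>auto intro: stationary_is_process\<close>)
  finally show ?thesis using in_run n by simp
qed

end

subsection \<open>Deviation of the estimated loss\<close>

lemma Skm_iff_nswitch:
  "\<sigma> \<in> Skm k m zs \<longleftrightarrow> (\<forall>c. nswitch (map \<sigma> (sorted_list_of_set (Tset k zs c))) \<le> m)"
proof -
  have "finite (Tset k zs c)" for c
    by (rule finite_subset[of _ "{..<length zs}"]) (auto simp: Tset_def)
  then show ?thesis
    unfolding Skm_def by (simp only: mem_Collect_eq card_consecutive_changes_eq_nswitch)
qed

lemma ctx_update:
  assumes "k \<le> t" "t' + k < t \<or> t' = t \<or> t + k < t'"
  shows "ctx k (zs[t' := z]) t = ctx k zs t"
proof -
  have "take k (drop a (zs[t' := z])) = take k (drop a zs)" if "t' < a \<or> a + k \<le> t'" for a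
    by (rule nth_equalityI) (use that in \<open>auto simp: nth_list_update\<close>)
  then show ?thesis using assms by (auto simp: ctx_def)
qed

lemma residue_class_separated:
  fixes k t t' :: nat
  assumes "t mod (k + 1) = t' mod (k + 1)"
  shows "t' + k < t \<or> t' = t \<or> t + k < t'"
proof (rule ccontr)
  assume "\<not> ?thesis"
  then have near: "t' \<noteq> t" "t < t' + (k + 1)" "t' < t + (k + 1)" by auto
  obtain q where "t' = t + (k + 1) * q \<or> t = t' + (k + 1) * q"
    using assms by (metis mod_eq_nat1E mod_eq_nat2E nat_le_linear)
  then show False using near by (cases q) auto
qed

lemma schedules_ctx_update:
  assumes "t' \<in> T" and T: "\<And>t. t \<in> T \<Longrightarrow> k \<le> t \<and> t mod (k + 1) = d"
  shows "schedules T (ctx k (zs[t' := z])) m = schedules T (ctx k zs) m"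
proof -
  have "ctx k (zs[t' := z]) t = ctx k zs t" if "t \<in> T" for t
    using T[OF that] T[OF assms(1)] by (intro ctx_update residue_class_separated) auto
  then have "{t \<in> T. ctx k (zs[t' := z]) t = c} = {t \<in> T. ctx k zs t = c}" for c by auto
  then show ?thesis by (simp add: schedules_def)
qed

lemma restrict_Skm_in_schedules:
  assumes "\<sigma> \<in> Skm k m zs" and T: "T \<subseteq> {k..<length zs - k}"
  shows "restrict \<sigma> T \<in> schedules T (ctx k zs) m"
proof -
  have "nswitch (map (restrict \<sigma> T) (sorted_list_of_set {t \<in> T. ctx k zs t = c})) \<le> m" for c
  proof -
    have sub: "{t \<in> T. ctx k zs t = c} \<subseteq> Tset k zs c" and fin: "finite (Tset k zs c)"
      using T by (auto simp: Tset_def intro: finite_subset[of _ "{..<length zs}"])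
    have "map (restrict \<sigma> T) (sorted_list_of_set {t \<in> T. ctx k zs t = c})
      = map \<sigma> (sorted_list_of_set {t \<in> T. ctx k zs t = c})"
      using finite_subset[OF sub fin] by simp
    also have "nswitch \<dots> \<le> nswitch (map \<sigma> (sorted_list_of_set (Tset k zs c)))"
      by (intro nswitch_subseq subseq_map subseq_sorted_list_of_set sub fin)
    also have "\<dots> \<le> m" using assms(1) unfolding Skm_iff_nswitch by blast
    finally show ?thesis .
  qed
  then show ?thesis by (simp add: schedules_def)
qed

abbreviation sdude_rate :: "('z::finite \<Rightarrow> 'xh::finite) itself \<Rightarrow> nat \<Rightarrow> nat \<Rightarrow> nat \<Rightarrow> real" where
  "sdude_rate T k m n \<equiv> schedule_rate (CARD('z) ^ (2 * k)) CARD('z \<Rightarrow> 'xh) m (n - 2 * k)"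

context memoryless_channel
begin

lemma channel_mean_residue_class_le:
  fixes f :: "'x \<Rightarrow> 'z \<Rightarrow> ('z \<Rightarrow> 'xh::finite) \<Rightarrow> real"
  assumes k: "2 * k < length xs" and m: "2 * m \<le> length xs - 2 * k"
    and mean: "\<And>x s. (\<Sum>z\<in>UNIV. Ch x z * f x z s) = 0"
    and width: "\<And>x z z' s. f x z s - f x z' s \<le> c" and l: "0 < l"
    and \<sigma>: "\<And>zs. length zs = length xs \<Longrightarrow> \<sigma> zs \<in> Skm k m zs"
    and T: "T = {t \<in> {k..<length xs - k}. t mod (k + 1) = d}"
  shows "\<E> xs (\<lambda>zs. \<Sum>t\<in>T. f (xs ! t) (zs ! t) (\<sigma> zs t))
    \<le> (real (length xs - 2 * k) * sdude_rate TYPE('z \<Rightarrow> 'xh) k m (length xs)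
      + real (card T) * (l\<^sup>2 * c\<^sup>2 / 8)) / l"
proof -
  let ?r = "length xs - 2 * k"
  let ?fam = "\<lambda>zs. schedules T (ctx k zs) m :: (nat \<Rightarrow> 'z \<Rightarrow> 'xh) set"
  let ?contexts = "words k \<times> words k :: ('z list \<times> 'z list) set"
  have finite_T: "finite T" by (simp add: T)
  have card_T: "card T \<le> ?r"
  proof -
    have "card T \<le> card {k..<length xs - k}" by (rule card_mono) (auto simp: T)
    then show ?thesis by simp
  qed
  have card_contexts: "card ?contexts = CARD('z) ^ (2 * k)"
    by (simp add: card_cartesian_product card_words mult_2 power_add)
  have "\<E> xs (\<lambda>zs. \<Sum>t\<in>T. f (xs ! t) (zs ! t) (restrict (\<sigma> zs) T t))
    \<le> (real ?r * sdude_rate TYPE('z \<Rightarrow> 'xh) k m (length xs)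
      + real (card T) * (l\<^sup>2 * c\<^sup>2 / 8)) / l"
  proof (rule channel_mean_selected_sum_le[where f = "\<lambda>t z s. f (xs ! t) z (s t)" and fam = ?fam])
    fix zs :: "'z list" assume zs: "length zs = length xs"
    show "restrict (\<sigma> zs) T \<in> ?fam zs"
      using zs by (intro restrict_Skm_in_schedules \<sigma>) (auto simp: T)
    show "real (card (?fam zs)) \<le> exp (real ?r * sdude_rate TYPE('z \<Rightarrow> 'xh) k m (length xs))"
      unfolding card_contexts[symmetric] using k m finite_T card_T zs
      by (intro card_schedules_le) (auto simp: ctx_def T)
  next
    fix t z and zs :: "'z list" assume "t \<in> T"
    then show "?fam (zs[t := z]) = ?fam zs"
      by (rule schedules_ctx_update) (simp add: T)
  next
    show "finite (T \<rightarrow>\<^sub>E (UNIV :: ('z \<Rightarrow> 'xh) set))" using finite_T by (intro finite_PiE) simp_all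
    show "?fam zs \<subseteq> T \<rightarrow>\<^sub>E UNIV" for zs by (auto simp: schedules_def)
    show "T \<subseteq> {..<length xs}" by (auto simp: T)
  qed (simp_all add: mean width l)
  then show ?thesis by simp
qed

lemma channel_mean_interior_le:
  fixes f :: "'x \<Rightarrow> 'z \<Rightarrow> ('z \<Rightarrow> 'xh::finite) \<Rightarrow> real"
  assumes k: "2 * k < length xs" and m: "2 * m \<le> length xs - 2 * k"
    and mean: "\<And>x s. (\<Sum>z\<in>UNIV. Ch x z * f x z s) = 0"
    and width: "\<And>x z z' s. f x z s - f x z' s \<le> c"
    and \<sigma>: "\<And>zs. length zs = length xs \<Longrightarrow> \<sigma> zs \<in> Skm k m zs"
  shows "\<E> xs (\<lambda>zs. \<Sum>t\<in>{k..<length xs - k}. f (xs ! t) (zs ! t) (\<sigma> zs t))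
    \<le> real (length xs - 2 * k)
      * sqrt (real (k + 1) * sdude_rate TYPE('z \<Rightarrow> 'xh) k m (length xs) * c\<^sup>2 / 2)"
    (is "?mean \<le> real ?r * sqrt (_ * ?\<beta> * _ / 2)")
proof -
  let ?T = "\<lambda>d. {t \<in> {k..<length xs - k}. t mod (k + 1) = d}"
  have group: "(\<Sum>t\<in>{k..<length xs - k}. g t) = (\<Sum>d<k + 1. \<Sum>t\<in>?T d. g t)" for g :: "nat \<Rightarrow> real"
    by (rule sum.group[symmetric]) auto
  have card_T: "(\<Sum>d<k + 1. real (card (?T d))) = real ?r"
    using group[of "\<lambda>_. 1"] by simp
  have "?mean \<le> (real (k + 1) * (real ?r * ?\<beta>)) / l + l * (real ?r * c\<^sup>2 / 8)" if l: "0 < l" for l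
  proof -
    have "?mean = (\<Sum>d<k + 1. \<E> xs (\<lambda>zs. \<Sum>t\<in>?T d. f (xs ! t) (zs ! t) (\<sigma> zs t)))"
      unfolding group by (rule channel_mean_sum)
    also have "\<dots> \<le> (\<Sum>d<k + 1. (real ?r * ?\<beta> + real (card (?T d)) * (l\<^sup>2 * c\<^sup>2 / 8)) / l)"
      by (intro sum_mono channel_mean_residue_class_le[OF k m mean width l \<sigma> refl])
    also have "\<dots> = (real (k + 1) * (real ?r * ?\<beta>) + real ?r * (l\<^sup>2 * c\<^sup>2 / 8)) / l"
      unfolding card_T[symmetric] sum_divide_distrib[symmetric] sum.distrib sum_distrib_right
      by simp
    also have "\<dots> = (real (k + 1) * (real ?r * ?\<beta>)) / l + l * (real ?r * c\<^sup>2 / 8)"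
      using l by (simp add: add_divide_distrib power2_eq_square)
    finally show ?thesis .
  qed
  moreover have "0 \<le> ?\<beta>" using k m by (intro schedule_rate_nonneg) auto
  ultimately have "?mean \<le> 2 * sqrt ((real (k + 1) * (real ?r * ?\<beta>)) * (real ?r * c\<^sup>2 / 8))"
    by (intro le_two_sqrt_mult) simp_all
  also have "\<dots> = sqrt (4 * ((real (k + 1) * (real ?r * ?\<beta>)) * (real ?r * c\<^sup>2 / 8)))"
    by (simp only: real_sqrt_mult real_sqrt_four)
  also have "4 * ((real (k + 1) * (real ?r * ?\<beta>)) * (real ?r * c\<^sup>2 / 8))
    = (real ?r)\<^sup>2 * (real (k + 1) * ?\<beta> * c\<^sup>2 / 2)"
    by (simp add: power2_eq_square)
  also have "sqrt \<dots> = real ?r * sqrt (real (k + 1) * ?\<beta> * c\<^sup>2 / 2)"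
    by (simp only: real_sqrt_mult real_sqrt_abs abs_of_nat)
  finally show ?thesis .
qed

end

subsection \<open>The genie\<close>

context denoising
begin

definition genie :: "(nat \<Rightarrow> (nat \<Rightarrow> 'x) measure) \<Rightarrow> nat list \<Rightarrow> nat \<Rightarrow> 'z list \<Rightarrow> nat \<Rightarrow> 'z \<Rightarrow> 'xh" where
  "genie Q as k zs t z =
     bayes_rule (2 * k + 1) (pfx (Q (as ! t))) k (fst (ctx k zs t) @ z # snd (ctx k zs t))"

abbreviation genie_denoiser ::
    "(nat \<Rightarrow> (nat \<Rightarrow> 'x) measure) \<Rightarrow> nat list \<Rightarrow> nat \<Rightarrow> 'z list \<Rightarrow> nat \<Rightarrow> 'xh" where
  "genie_denoiser Q as k zs t \<equiv> genie Q as k zs t (zs ! t)"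

lemma genie_update:
  "k \<le> t \<Longrightarrow> genie Q as k (zs[t := z]) t = genie Q as k zs t"
  by (rule ext) (simp add: genie_def ctx_update)

lemma genie_in_Skm:
  assumes "length zs = length as" "nswitch as \<le> m"
  shows "genie Q as k zs \<in> Skm k m zs"
  unfolding Skm_iff_nswitch
proof
  fix c
  let ?L = "sorted_list_of_set (Tset k zs c)"
  let ?rule = "\<lambda>a z. bayes_rule (2 * k + 1) (pfx (Q a)) k (fst c @ z # snd c)"
  have sub: "Tset k zs c \<subseteq> {..<length as}" using assms(1) by (auto simp: Tset_def)
  have "map (genie Q as k zs) ?L = map ?rule (map ((!) as) ?L)"
    using finite_subset[OF sub] by (auto simp: genie_def Tset_def)
  also have "nswitch \<dots> \<le> nswitch (map ((!) as) ?L)"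
    by (rule nswitch_map_le)
  also have "\<dots> \<le> nswitch (map ((!) as) (sorted_list_of_set {..<length as}))"
    by (intro nswitch_subseq subseq_map subseq_sorted_list_of_set sub) simp
  also have "map ((!) as) (sorted_list_of_set {..<length as}) = as"
    by (simp add: lessThan_atLeast0 map_nth)
  finally show "nswitch (map (genie Q as k zs) ?L) \<le> m" using assms(2) by simp
qed

lemma genie_denoiser_eq_window_rule:
  assumes "k \<le> t" "t + k < length zs"
  shows "genie_denoiser Q as k zs t
    = bayes_rule (2 * k + 1) (pfx (Q (as ! t))) k (take (2 * k + 1) (drop (t - k) zs))"
proof -
  have "take (k + (1 + k)) (drop (t - k) zs) =
    take k (drop (t - k) zs) @ take (1 + k) (drop (k + (t - k)) zs)"
    by (simp only: take_add drop_drop)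
  also have "take (1 + k) (drop (k + (t - k)) zs) = zs ! t # take k (drop (Suc t) zs)"
    using assms by (simp flip: Cons_nth_drop_Suc)
  finally show ?thesis by (simp add: genie_def ctx_def mult_2)
qed

lemma regime_loss_genie_eq_window_risk:
  assumes as: "as = us @ replicate l a @ vs" and run: "maximal_run us l a vs"
    and Q: "\<And>x. x \<in> set as \<Longrightarrow> is_stationary (Q x)"
    and window: "length us + k \<le> t" "t + k < length us + l"
  shows "regime_loss Q as (genie_denoiser Q as k) t = window_risk (Q a) k"
proof -
  let ?s = "length us" and ?b = "length vs" and ?w = "2 * k + 1"
  let ?d = "bayes_rule ?w (pfx (Q a)) k"
  define p where "p = t - k - ?s"
  define c where "c = l - (p + ?w)"
  have l: "l = p + (?w + c)" and t: "t = ?s + (p + k)" "t - k = ?s + p"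
    using window by (simp_all add: p_def c_def)
  have n: "length as = ?s + (l + ?b)" by (simp add: as)
  have at: "as ! t = a" and mem: "a \<in> set as" using window by (auto simp: as nth_append)
  have process: "is_process (Q x)" if "x \<in> set us \<union> set vs" for x
    using Q[of x] that by (auto simp: as stationary_is_process)
  have "regime_loss Q as (genie_denoiser Q as k) t
    = mean_loss (?s + (l + ?b)) (block_prod Q as)
        (\<lambda>zs. (\<lambda>ys. ?d (take ?w (drop p ys))) (take l (drop ?s zs))) (?s + (p + k))"
    unfolding n t(1)[symmetric]
  proof (rule mean_loss_cong)
    fix zs :: "'z list" assume "length zs = ?s + (l + ?b)"
    then have "genie_denoiser Q as k zs t = ?d (take ?w (drop (t - k) zs))"
      using window genie_denoiser_eq_window_rule[of k t zs Q as] by (simp add: at)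
    then show "genie_denoiser Q as k zs t = ?d (take ?w (drop p (take l (drop ?s zs))))"
      by (simp add: t(2) l drop_take add.commute)
  qed
  also have "\<dots> = mean_loss l (pfx (Q a)) (\<lambda>ys. ?d (take ?w (drop p ys))) (p + k)"
  proof (rule mean_loss_window)
    fix v :: "'x list" assume v: "length v = l"
    show "(\<Sum>u\<in>words ?s. \<Sum>w\<in>words ?b. block_prod Q as (u @ v @ w)) = pfx (Q a) v"
      unfolding as by (rule sum_block_prod_outside_run[OF run v process])
  qed (simp add: l)
  also have "\<dots> = mean_loss ?w (pfx (Q a)) ?d k"
    unfolding l using Q[OF mem] by (intro mean_loss_window) (simp_all add: sum_pfx_window)
  finally show ?thesis by (simp only: mean_loss_bayes_rule window_risk_def)
qed

lemma regime_loss_genie_le: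
  assumes Q: "\<And>a. a \<in> set as \<Longrightarrow> is_stationary (Q a)"
    and excess: "\<And>a. a \<in> set as \<Longrightarrow> window_risk (Q a) k \<le> limit_risk (Q a) + \<Delta>" "0 \<le> \<Delta>"
    and t: "k \<le> t" "t + k < length as"
  shows "regime_loss Q as (genie_denoiser Q as k) t
    \<le> limit_risk (Q (as ! t)) + \<Delta> + (if t \<in> near_switch k as then Lambda_max \<Lambda> else 0)"
proof -
  have process: "is_process (Q a)" if "a \<in> set as" for a
    by (intro stationary_is_process Q that)
  have mem: "as ! t \<in> set as" using t by simp
  show ?thesis
  proof (cases "t \<in> near_switch k as")
    case True
    have "regime_loss Q as (genie_denoiser Q as k) t \<le> Lambda_max \<Lambda>"
      by (intro mean_loss_le_Lambda_max word_distribution_block_prod process)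
    then show ?thesis using True limit_risk_nonneg[OF process[OF mem]] excess(2) by simp
  next
    case False
    have "t < length as" using t(2) by simp
    then obtain us l vs where as: "as = us @ replicate l (as ! t) @ vs"
      and run: "maximal_run us l (as ! t) vs" and in_run: "length us \<le> t" "t < length us + l"
      using maximal_run_at by blast
    have "regime_loss Q as (genie_denoiser Q as k) t = window_risk (Q (as ! t)) k"
      using window_within_run[OF as run False t in_run]
      by (intro regime_loss_genie_eq_window_risk[OF as run Q])
    then show ?thesis using False excess(1)[OF mem] by simp
  qed
qed

lemma sum_regime_loss_genie_le:
  assumes Q: "\<And>a. a \<in> set as \<Longrightarrow> is_stationary (Q a)"
    and excess: "\<And>a. a \<in> set as \<Longrightarrow> window_risk (Q a) k \<le> limit_risk (Q a) + \<Delta>" "0 \<le> \<Delta>"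
  shows "(\<Sum>t\<in>{k..<length as - k}. regime_loss Q as (genie_denoiser Q as k) t)
    \<le> (\<Sum>t<length as. limit_risk (Q (as ! t))) + real (length as) * \<Delta>
      + real (2 * k * nswitch as) * Lambda_max \<Lambda>"
proof -
  let ?I = "{k..<length as - k}" and ?bad = "\<lambda>t. if t \<in> near_switch k as then Lambda_max \<Lambda> else 0"
  have "(\<Sum>t\<in>?I. regime_loss Q as (genie_denoiser Q as k) t)
    \<le> (\<Sum>t\<in>?I. limit_risk (Q (as ! t)) + \<Delta> + ?bad t)"
    by (intro sum_mono regime_loss_genie_le Q excess) auto
  also have "\<dots> = (\<Sum>t\<in>?I. limit_risk (Q (as ! t)) + \<Delta>) + (\<Sum>t\<in>?I. ?bad t)"
    by (rule sum.distrib)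
  also have "(\<Sum>t\<in>?I. limit_risk (Q (as ! t)) + \<Delta>) \<le> (\<Sum>t<length as. limit_risk (Q (as ! t)) + \<Delta>)"
    using Q excess(2)
    by (intro sum_mono2) (auto intro!: add_nonneg_nonneg limit_risk_nonneg stationary_is_process)
  also have "\<dots> = (\<Sum>t<length as. limit_risk (Q (as ! t))) + real (length as) * \<Delta>"
    by (simp add: sum.distrib)
  also have "(\<Sum>t\<in>?I. ?bad t) = real (card (?I \<inter> near_switch k as)) * Lambda_max \<Lambda>"
    by (simp add: sum.If_cases)
  also have "\<dots> \<le> real (2 * k * nswitch as) * Lambda_max \<Lambda>"
  proof (intro mult_right_mono of_nat_mono Lambda_max_nonneg)
    have "card (?I \<inter> near_switch k as) \<le> card (near_switch k as)"
      by (rule card_mono[OF finite_near_switch]) simp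
    also note card_near_switch_le
    finally show "card (?I \<inter> near_switch k as) \<le> 2 * k * nswitch as" .
  qed
  finally show ?thesis by simp
qed

end

subsection \<open>The S-DUDE against the genie\<close>

locale estimated_loss = denoising Ch \<Lambda>
  for Ch :: "'x::finite \<Rightarrow> 'z::finite \<Rightarrow> real" and \<Lambda> :: "'x \<Rightarrow> 'xh::finite \<Rightarrow> real" +
  fixes H :: "'z \<Rightarrow> 'x \<Rightarrow> real"
  assumes right_inverse: "right_inverse Ch H"
begin

abbreviation estimation_error :: "'x \<Rightarrow> 'z \<Rightarrow> ('z \<Rightarrow> 'xh) \<Rightarrow> real" where
  "estimation_error x z s \<equiv> \<Lambda> x (s z) - ell Ch H \<Lambda> z s"

abbreviation deviation_bound :: "nat \<Rightarrow> nat \<Rightarrow> nat \<Rightarrow> real" where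
  "deviation_bound k m n \<equiv>
    sqrt (real (k + 1) * sdude_rate TYPE('z \<Rightarrow> 'xh) k m n * (L_max Ch H \<Lambda>)\<^sup>2 / 2)"

lemma estimation_error_mean: "(\<Sum>z\<in>UNIV. Ch x z * estimation_error x z s) = 0"
proof -
  have "(\<Sum>z\<in>UNIV. Ch x z * ell Ch H \<Lambda> z s) = (\<Sum>x'\<in>UNIV. (\<Sum>z\<in>UNIV. Ch x z * H z x') * rho Ch \<Lambda> x' s)"
    unfolding ell_def sum_distrib_left sum_distrib_right
    by (subst sum.swap) (simp add: mult.assoc)
  also have "\<dots> = (\<Sum>x'\<in>UNIV. if x = x' then rho Ch \<Lambda> x' s else 0)"
    using right_inverse by (intro sum.cong) (auto simp: right_inverse_def)
  also have "\<dots> = (\<Sum>z\<in>UNIV. Ch x z * \<Lambda> x (s z))"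
    by (simp add: rho_def mult.commute)
  finally show ?thesis by (simp add: right_diff_distrib sum_subtractf)
qed

lemma estimation_error_width: "estimation_error x z s - estimation_error x z' s \<le> L_max Ch H \<Lambda>"
proof -
  let ?R = "range (\<lambda>(z, s). ell Ch H \<Lambda> z s)"
  have mem: "ell Ch H \<Lambda> z s \<in> ?R" for z s by (rule image_eqI[where x = "(z, s)"]) simp_all
  have "ell Ch H \<Lambda> z' s - ell Ch H \<Lambda> z s \<le> ell_max Ch H \<Lambda>"
    unfolding ell_max_def by (intro diff_mono Max_ge Min_le mem) simp_all
  then show ?thesis
    using loss_le_Lambda_max[of x "s z"] loss_nonneg[of x "s z'"] unfolding L_max_def by linarith
qed

lemma channel_mean_loss_eq_ell:
  assumes "T \<subseteq> {..<length xs}"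
    and \<gamma>: "\<And>zs t z. t \<in> T \<Longrightarrow> \<gamma> (zs[t := z]) t = \<gamma> zs t"
  shows "\<E> xs (\<lambda>zs. \<Sum>t\<in>T. \<Lambda> (xs ! t) (\<gamma> zs t (zs ! t)))
    = \<E> xs (\<lambda>zs. \<Sum>t\<in>T. ell Ch H \<Lambda> (zs ! t) (\<gamma> zs t))"
proof -
  let ?err = "\<lambda>zs t. estimation_error (xs ! t) (zs ! t) (\<gamma> zs t)"
  have mean_0: "\<E> xs (\<lambda>zs. ?err zs t) = 0" if "t \<in> T" for t
  proof -
    have t: "t < length xs" using that assms(1) by auto
    have "\<E> xs (\<lambda>zs. ?err zs t)
      = \<E> xs (\<lambda>zs. \<Sum>z\<in>UNIV. Ch (xs ! t) z * estimation_error (xs ! t) z (\<gamma> zs t))"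
      unfolding channel_mean_resample[OF t, of "\<lambda>zs. ?err zs t"]
      using t by (intro channel_mean_cong sum.cong refl) (simp add: \<gamma>[OF that])
    then show ?thesis by (simp only: estimation_error_mean channel_mean_const)
  qed
  have "\<E> xs (\<lambda>zs. \<Sum>t\<in>T. \<Lambda> (xs ! t) (\<gamma> zs t (zs ! t)))
    = \<E> xs (\<lambda>zs. (\<Sum>t\<in>T. ell Ch H \<Lambda> (zs ! t) (\<gamma> zs t)) + (\<Sum>t\<in>T. ?err zs t))"
    by (simp add: sum_subtractf)
  also have "\<dots> = \<E> xs (\<lambda>zs. \<Sum>t\<in>T. ell Ch H \<Lambda> (zs ! t) (\<gamma> zs t)) + (\<Sum>t\<in>T. \<E> xs (\<lambda>zs. ?err zs t))"
    by (simp only: channel_mean_add channel_mean_sum)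
  finally show ?thesis by (simp add: mean_0)
qed

lemma sdude_obtains_rules:
  assumes "is_sdude Ch H \<Lambda> k m n D" and k: "2 * k < n"
  obtains \<sigma> where "\<And>zs. length zs = n \<Longrightarrow> \<sigma> zs \<in> Skm k m zs"
    "\<And>zs \<sigma>'. \<lbrakk>length zs = n; \<sigma>' \<in> Skm k m zs\<rbrakk> \<Longrightarrow>
      (\<Sum>t\<in>{k..<n - k}. ell Ch H \<Lambda> (zs ! t) (\<sigma> zs t))
        \<le> (\<Sum>t\<in>{k..<n - k}. ell Ch H \<Lambda> (zs ! t) (\<sigma>' t))"
    "\<And>zs t. \<lbrakk>length zs = n; t \<in> {k..<n - k}\<rbrakk> \<Longrightarrow> D zs t = \<sigma> zs t (zs ! t)"
proof -
  have "\<exists>\<sigma>\<in>Skm k m zs. (\<forall>\<sigma>'\<in>Skm k m zs. sdude_cost Ch H \<Lambda> k zs \<sigma> \<le> sdude_cost Ch H \<Lambda> k zs \<sigma>') \<and>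
      (\<forall>t\<in>{k..<n - k}. D zs t = \<sigma> t (zs ! t))" if zs: "length zs = n" for zs
  proof -
    obtain \<sigma> x0 where "\<sigma> \<in> Skm k m zs"
      "\<forall>\<sigma>'\<in>Skm k m zs. sdude_cost Ch H \<Lambda> k zs \<sigma> \<le> sdude_cost Ch H \<Lambda> k zs \<sigma>'"
      "\<forall>t<n. D zs t = (if k \<le> t \<and> t < n - k then \<sigma> t (zs ! t) else x0)"
      using assms(1) zs unfolding is_sdude_def by blast
    then show ?thesis by (intro bexI[of _ \<sigma>]) auto
  qed
  then obtain \<sigma> where \<sigma>: "\<sigma> zs \<in> Skm k m zs"
      "\<forall>\<sigma>'\<in>Skm k m zs. sdude_cost Ch H \<Lambda> k zs (\<sigma> zs) \<le> sdude_cost Ch H \<Lambda> k zs \<sigma>'"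
      "\<forall>t\<in>{k..<n - k}. D zs t = \<sigma> zs t (zs ! t)" if "length zs = n" for zs
    unfolding Bex_def by metis
  show ?thesis
  proof (rule that)
    fix zs :: "'z list" and \<sigma>' :: "nat \<Rightarrow> 'z \<Rightarrow> 'xh"
    assume "length zs = n" "\<sigma>' \<in> Skm k m zs"
    then show "(\<Sum>t\<in>{k..<n - k}. ell Ch H \<Lambda> (zs ! t) (\<sigma> zs t))
        \<le> (\<Sum>t\<in>{k..<n - k}. ell Ch H \<Lambda> (zs ! t) (\<sigma>' t))"
      using \<sigma>(2) k by (simp add: sdude_cost_def divide_le_cancel)
  qed (use \<sigma> in auto)
qed

lemma channel_mean_sdude_loss_le:
  assumes k: "2 * k < length xs" and m: "2 * m \<le> length xs - 2 * k"
    and D: "is_sdude Ch H \<Lambda> k m (length xs) D"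
    and \<gamma>: "\<And>zs. length zs = length xs \<Longrightarrow> \<gamma> zs \<in> Skm k m zs"
      "\<And>zs t z. k \<le> t \<Longrightarrow> \<gamma> (zs[t := z]) t = \<gamma> zs t"
  shows "\<E> xs (\<lambda>zs. \<Sum>t\<in>{k..<length xs - k}. \<Lambda> (xs ! t) (D zs t))
    \<le> \<E> xs (\<lambda>zs. \<Sum>t\<in>{k..<length xs - k}. \<Lambda> (xs ! t) (\<gamma> zs t (zs ! t)))
      + real (length xs - 2 * k) * deviation_bound k m (length xs)"
proof -
  let ?I = "{k..<length xs - k}" and ?r = "length xs - 2 * k"
  obtain \<sigma> where \<sigma>: "\<And>zs. length zs = length xs \<Longrightarrow> \<sigma> zs \<in> Skm k m zs"
    and minimal: "\<And>zs \<sigma>'. \<lbrakk>length zs = length xs; \<sigma>' \<in> Skm k m zs\<rbrakk> \<Longrightarrow>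
      (\<Sum>t\<in>?I. ell Ch H \<Lambda> (zs ! t) (\<sigma> zs t)) \<le> (\<Sum>t\<in>?I. ell Ch H \<Lambda> (zs ! t) (\<sigma>' t))"
    and D_eq: "\<And>zs t. \<lbrakk>length zs = length xs; t \<in> ?I\<rbrakk> \<Longrightarrow> D zs t = \<sigma> zs t (zs ! t)"
    using sdude_obtains_rules[OF D k] by blast
  have "\<E> xs (\<lambda>zs. \<Sum>t\<in>?I. \<Lambda> (xs ! t) (D zs t))
    = \<E> xs (\<lambda>zs. (\<Sum>t\<in>?I. estimation_error (xs ! t) (zs ! t) (\<sigma> zs t))
        + (\<Sum>t\<in>?I. ell Ch H \<Lambda> (zs ! t) (\<sigma> zs t)))"
    by (rule channel_mean_cong) (simp add: D_eq sum_subtractf)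
  also have "\<dots> = \<E> xs (\<lambda>zs. \<Sum>t\<in>?I. estimation_error (xs ! t) (zs ! t) (\<sigma> zs t))
      + \<E> xs (\<lambda>zs. \<Sum>t\<in>?I. ell Ch H \<Lambda> (zs ! t) (\<sigma> zs t))"
    by (rule channel_mean_add)
  also have "\<dots> \<le> real ?r * deviation_bound k m (length xs)
      + \<E> xs (\<lambda>zs. \<Sum>t\<in>?I. ell Ch H \<Lambda> (zs ! t) (\<gamma> zs t))"
    by (intro add_mono channel_mean_interior_le k m estimation_error_mean estimation_error_width \<sigma>
        channel_mean_mono minimal \<gamma>(1))
  also have "\<E> xs (\<lambda>zs. \<Sum>t\<in>?I. ell Ch H \<Lambda> (zs ! t) (\<gamma> zs t))
    = \<E> xs (\<lambda>zs. \<Sum>t\<in>?I. \<Lambda> (xs ! t) (\<gamma> zs t (zs ! t)))"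
    by (rule channel_mean_loss_eq_ell[symmetric]) (auto simp: \<gamma>(2))
  finally show ?thesis by simp
qed

lemma sum_regime_loss_sdude_le_genie:
  assumes k: "2 * k < length as" and m: "2 * m \<le> length as - 2 * k" "nswitch as \<le> m"
    and D: "is_sdude Ch H \<Lambda> k m (length as) D"
    and Q: "\<And>a. a \<in> set as \<Longrightarrow> is_process (Q a)"
  shows "(\<Sum>t\<in>{k..<length as - k}. regime_loss Q as D t)
    \<le> (\<Sum>t\<in>{k..<length as - k}. regime_loss Q as (genie_denoiser Q as k) t)
      + real (length as - 2 * k) * deviation_bound k m (length as)"
    (is "_ \<le> ?genie + ?dev")
proof -
  let ?n = "length as" and ?I = "{k..<length as - k}"
  have W: "word_distribution ?n (block_prod Q as)" by (rule word_distribution_block_prod[OF Q])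
  have "(\<Sum>t\<in>?I. regime_loss Q as D t)
    \<le> (\<Sum>xs\<in>words ?n. block_prod Q as xs
        * (\<E> xs (\<lambda>zs. \<Sum>t\<in>?I. \<Lambda> (xs ! t) (genie_denoiser Q as k zs t)) + ?dev))"
    unfolding sum_mean_loss
  proof (intro sum_mono mult_left_mono block_prod_nonneg)
    fix xs :: "'x list" assume "xs \<in> words ?n"
    then have xs: "?n = length xs" by simp
    show "\<E> xs (\<lambda>zs. \<Sum>t\<in>?I. \<Lambda> (xs ! t) (D zs t))
      \<le> \<E> xs (\<lambda>zs. \<Sum>t\<in>?I. \<Lambda> (xs ! t) (genie_denoiser Q as k zs t)) + ?dev"
      unfolding xs using k m D unfolding xs
      by (intro channel_mean_sdude_loss_le) (simp_all add: genie_update genie_in_Skm xs)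
  qed
  also have "\<dots> = ?genie + (\<Sum>xs\<in>words ?n. block_prod Q as xs) * ?dev"
    unfolding sum_mean_loss by (simp only: distrib_left sum.distrib sum_distrib_right)
  finally show ?thesis using W by (simp add: word_distribution_def)
qed

lemma sum_regime_loss_sdude_le:
  assumes k: "2 * k < length as" and m: "2 * m \<le> length as - 2 * k" "nswitch as \<le> m"
    and D: "is_sdude Ch H \<Lambda> k m (length as) D"
    and Q: "\<And>a. a \<in> set as \<Longrightarrow> is_stationary (Q a)"
    and excess: "\<And>a. a \<in> set as \<Longrightarrow> window_risk (Q a) k \<le> limit_risk (Q a) + \<Delta>" "0 \<le> \<Delta>"
  shows "(\<Sum>t<length as. regime_loss Q as D t)
    \<le> (\<Sum>t<length as. limit_risk (Q (as ! t))) + real (length as) * \<Delta>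
      + 2 * Lambda_max \<Lambda> * (real (k + 1) * real (m + 1))
      + real (length as - 2 * k) * deviation_bound k m (length as)"
    (is "_ \<le> ?limit + ?n\<Delta> + _ + ?dev")
proof -
  let ?n = "length as" and ?I = "{k..<length as - k}"
  let ?loss = "regime_loss Q as D"
  have process: "is_process (Q a)" if "a \<in> set as" for a
    by (intro stationary_is_process Q that)
  have I: "?I \<subseteq> {..<?n}" by auto
  have "(\<Sum>t\<in>{..<?n} - ?I. ?loss t) \<le> (\<Sum>t\<in>{..<?n} - ?I. Lambda_max \<Lambda>)"
    by (intro sum_mono mean_loss_le_Lambda_max word_distribution_block_prod process)
  also have "\<dots> = real (2 * k) * Lambda_max \<Lambda>"
  proof -
    have "card ({..<?n} - ?I) = 2 * k" using k by (simp add: card_Diff_subset[OF _ I])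
    then show ?thesis by simp
  qed
  finally have boundary: "(\<Sum>t\<in>{..<?n} - ?I. ?loss t) \<le> real (2 * k) * Lambda_max \<Lambda>" .
  have "(\<Sum>t\<in>?I. ?loss t)
    \<le> (\<Sum>t\<in>?I. regime_loss Q as (genie_denoiser Q as k) t) + ?dev"
    by (rule sum_regime_loss_sdude_le_genie[OF k m D process])
  also have "(\<Sum>t\<in>?I. regime_loss Q as (genie_denoiser Q as k) t)
    \<le> ?limit + ?n\<Delta> + real (2 * k * nswitch as) * Lambda_max \<Lambda>"
    by (rule sum_regime_loss_genie_le[OF Q excess])
  finally have interior: "(\<Sum>t\<in>?I. ?loss t)
    \<le> ?limit + ?n\<Delta> + real (2 * k * nswitch as) * Lambda_max \<Lambda> + ?dev" by simp
  have "(\<Sum>t<?n. ?loss t)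
    \<le> real (2 * k) * Lambda_max \<Lambda>
      + (?limit + ?n\<Delta> + real (2 * k * nswitch as) * Lambda_max \<Lambda> + ?dev)"
    using boundary interior sum.subset_diff[OF I, of ?loss] by simp
  moreover have "real (2 * k + 2 * k * nswitch as) * Lambda_max \<Lambda>
    \<le> real (2 * ((k + 1) * (m + 1))) * Lambda_max \<Lambda>"
  proof (intro mult_right_mono of_nat_mono Lambda_max_nonneg)
    have "2 * k + 2 * k * nswitch as = 2 * (k * (nswitch as + 1))" by simp
    also have "\<dots> \<le> 2 * ((k + 1) * (m + 1))" using m by (intro mult_left_mono mult_mono) auto
    finally show "2 * k + 2 * k * nswitch as \<le> 2 * ((k + 1) * (m + 1))" .
  qed
  ultimately show ?thesis by (simp add: algebra_simps)
qed

end

subsection \<open>Switching sources\<close>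

lemma pfx_eq_0_if_many_switches:
  assumes A: "is_process A" and switches: "AE \<omega> in A. nswitch (map \<omega> [0..<length as]) \<le> m"
    and as: "\<not> nswitch as \<le> m"
  shows "pfx A as = 0"
proof -
  let ?C = "{\<omega>. \<forall>i<length as. \<omega> i = as ! i}"
  have "\<omega> \<notin> ?C" if "nswitch (map \<omega> [0..<length as]) \<le> m" for \<omega>
  proof
    assume "\<omega> \<in> ?C"
    then have "map \<omega> [0..<length as] = as" by (intro nth_equalityI) auto
    then show False using that as by simp
  qed
  then have "AE \<omega> in A. \<omega> \<notin> ?C"
    using switches by (rule eventually_mono[rotated])
  then have "?C \<in> null_sets A"
    by (subst AE_iff_null_sets[OF cylinder_sets[OF A]])
  then show ?thesis unfolding pfx_eq[OF A] measure_def by (simp only: null_setsD1 enn2real_0)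
qed

locale switching_source =
  fixes P :: "(nat \<Rightarrow> 'x::finite) measure" and A :: "(nat \<Rightarrow> nat) measure"
    and N :: nat and Q :: "nat \<Rightarrow> (nat \<Rightarrow> 'x) measure"
  assumes P: "is_process P" and A: "is_process A"
    and Q: "a \<in> {1..N} \<Longrightarrow> is_stationary (Q a)"
    and mixture: "pfx P xs =
      (\<Sum>as\<in>{as. length as = length xs \<and> set as \<subseteq> {1..N}}. pfx A as * block_prod Q as xs)"
begin

abbreviation regimes :: "nat \<Rightarrow> nat list set" where
  "regimes n \<equiv> {as. length as = n \<and> set as \<subseteq> {1..N}}"

lemma word_distribution_regime:
  assumes "as \<in> regimes n"
  shows "word_distribution n (block_prod Q as)"
proof -
  have "is_process (Q a)" if "a \<in> set as" for a
    using assms that by (intro stationary_is_process Q) auto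
  from word_distribution_block_prod[of as Q, OF this] show ?thesis using assms by simp
qed

lemma sum_pfx_regimes: "(\<Sum>as\<in>regimes n. pfx A as) = 1"
proof -
  have total: "(\<Sum>xs\<in>words n. block_prod Q as xs) = 1" if "as \<in> regimes n" for as
    using word_distribution_regime[OF that] by (simp add: word_distribution_def)
  have "1 = (\<Sum>xs\<in>words n. \<Sum>as\<in>regimes n. pfx A as * block_prod Q as xs)"
    using word_distribution_pfx[OF P, of n] by (simp add: word_distribution_def mixture)
  also have "\<dots> = (\<Sum>as\<in>regimes n. pfx A as * (\<Sum>xs\<in>words n. block_prod Q as xs))"
    unfolding sum_distrib_left by (rule sum.swap)
  also have "\<dots> = (\<Sum>as\<in>regimes n. pfx A as)"
    by (intro sum.cong refl) (simp only: total mult_1_right)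
  finally show ?thesis by simp
qed

end

locale denoising_switching_source = estimated_loss Ch \<Lambda> H + switching_source P A N Q
  for Ch :: "'x::finite \<Rightarrow> 'z::finite \<Rightarrow> real" and \<Lambda> :: "'x \<Rightarrow> 'xh::finite \<Rightarrow> real"
    and H :: "'z \<Rightarrow> 'x \<Rightarrow> real" and P :: "(nat \<Rightarrow> 'x) measure" and A N
    and Q :: "nat \<Rightarrow> (nat \<Rightarrow> 'x) measure"
begin

definition regime_risk :: "nat \<Rightarrow> real" where
  "regime_risk n = (\<Sum>as\<in>regimes n. pfx A as * ((1 / real n) * (\<Sum>t<n. limit_risk (Q (as ! t)))))"

definition excess_risk :: "nat \<Rightarrow> real" where
  "excess_risk k = (\<Sum>a\<in>{1..N}. window_risk (Q a) k - limit_risk (Q a))"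

lemma exp_loss_eq:
  "exp_loss Ch \<Lambda> P n D =
    (\<Sum>as\<in>regimes n. pfx A as * ((1 / real n) * (\<Sum>t<n. regime_loss Q as D t)))"
proof -
  let ?L = "\<lambda>xs. (1 / real n) * \<E> xs (\<lambda>zs. \<Sum>t<n. \<Lambda> (xs ! t) (D zs t))"
  have "exp_loss Ch \<Lambda> P n D = (\<Sum>xs\<in>words n. pfx P xs * ?L xs)"
    unfolding exp_loss_def channel_mean_cmult[symmetric]
    by (intro sum.cong refl) (simp only: channel_mean_def mem_Collect_eq mult_ac)
  also have "\<dots> = (\<Sum>xs\<in>words n. \<Sum>as\<in>regimes n. pfx A as * block_prod Q as xs * ?L xs)"
    by (intro sum.cong refl) (simp only: mixture sum_distrib_right mem_Collect_eq)
  also have "\<dots> = (\<Sum>as\<in>regimes n. \<Sum>xs\<in>words n. pfx A as * block_prod Q as xs * ?L xs)"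
    by (rule sum.swap)
  also have "\<dots> = (\<Sum>as\<in>regimes n. pfx A as * ((1 / real n) * (\<Sum>t<n. regime_loss Q as D t)))"
    unfolding sum_mean_loss sum_distrib_left
    by (rule sum.cong[OF refl], rule sum.cong) (simp_all only: mem_Collect_eq mult_ac)
  finally show ?thesis .
qed

lemma regime_risk_le_exp_loss: "regime_risk n \<le> exp_loss Ch \<Lambda> P n D"
  unfolding exp_loss_eq regime_risk_def
proof (intro sum_mono mult_left_mono pfx_nonneg)
  fix as t assume "as \<in> regimes n" "t \<in> {..<n}"
  then have "t < length as" "n = length as" "\<And>a. a \<in> set as \<Longrightarrow> is_stationary (Q a)"
    using Q by auto
  then show "limit_risk (Q (as ! t)) \<le> regime_loss Q as D t"
    using limit_risk_le_regime_loss by blast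
qed simp

lemma regime_risk_le_DD: "regime_risk n \<le> DD Ch \<Lambda> P n"
  unfolding DD_def by (rule cINF_greatest) (simp_all add: regime_risk_le_exp_loss)

lemma DD_le_exp_loss: "DD Ch \<Lambda> P n \<le> exp_loss Ch \<Lambda> P n D"
  unfolding DD_def by (rule cINF_lower[OF bdd_belowI2[OF regime_risk_le_exp_loss]]) simp

lemma excess_risk_nonneg: "0 \<le> excess_risk k"
  unfolding excess_risk_def using Q
  by (intro sum_nonneg) (simp add: limit_risk_le_window_risk stationary_is_process)

lemma window_risk_le_excess_risk:
  assumes "a \<in> {1..N}"
  shows "window_risk (Q a) k \<le> limit_risk (Q a) + excess_risk k"
proof -
  have "window_risk (Q a) k - limit_risk (Q a) \<le> excess_risk k"
    unfolding excess_risk_def using Q assms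
    by (intro member_le_sum[where f = "\<lambda>a. window_risk (Q a) k - limit_risk (Q a)"])
      (auto simp: limit_risk_le_window_risk stationary_is_process)
  then show ?thesis by simp
qed

lemma excess_risk_tendsto_0: "excess_risk \<longlonglongrightarrow> 0"
proof -
  have "excess_risk \<longlonglongrightarrow> (\<Sum>a\<in>{1..N}. limit_risk (Q a) - limit_risk (Q a))"
    unfolding excess_risk_def
    by (intro tendsto_sum tendsto_diff tendsto_const window_risk_tendsto Q)
  then show ?thesis by simp
qed

lemma exp_loss_sdude_le:
  assumes k: "2 * k < n" and m: "2 * m \<le> n - 2 * k"
    and D: "is_sdude Ch H \<Lambda> k m n D" and switches: "AE \<omega> in A. nswitch (map \<omega> [0..<n]) \<le> m"
  shows "exp_loss Ch \<Lambda> P n D \<le> regime_risk n + (1 / real n) * (real n * excess_risk k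
      + 2 * Lambda_max \<Lambda> * (real (k + 1) * real (m + 1))
      + real (n - 2 * k) * deviation_bound k m n)"
    (is "_ \<le> _ + (1 / real n) * ?R")
proof -
  have "exp_loss Ch \<Lambda> P n D
    \<le> (\<Sum>as\<in>regimes n. pfx A as * ((1 / real n) * ((\<Sum>t<n. limit_risk (Q (as ! t))) + ?R)))"
    unfolding exp_loss_eq
  proof (rule sum_mono)
    fix as assume as: "as \<in> regimes n"
    let ?loss = "\<Sum>t<n. regime_loss Q as D t"
    have n: "n = length as" using as by simp
    have Q_as: "\<And>a. a \<in> set as \<Longrightarrow> a \<in> {1..N}" using as by auto
    show "pfx A as * ((1 / real n) * ?loss)
      \<le> pfx A as * ((1 / real n) * ((\<Sum>t<n. limit_risk (Q (as ! t))) + ?R))"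
    proof (cases "nswitch as \<le> m")
      case True
      have "?loss \<le> (\<Sum>t<n. limit_risk (Q (as ! t))) + ?R"
        using sum_regime_loss_sdude_le[OF _ _ True, of k D Q "excess_risk k"] k m D
          Q[OF Q_as] window_risk_le_excess_risk[OF Q_as] excess_risk_nonneg
        by (simp add: n add.assoc)
      then show ?thesis by (intro mult_left_mono pfx_nonneg) simp_all
    next
      case False
      then have "pfx A as = 0" using pfx_eq_0_if_many_switches[OF A] switches n by blast
      then show ?thesis by simp
    qed
  qed
  also have "\<dots> = regime_risk n + (\<Sum>as\<in>regimes n. pfx A as) * ((1 / real n) * ?R)"
    unfolding regime_risk_def by (simp only: distrib_left sum.distrib sum_distrib_right)
  finally show ?thesis by (simp only: sum_pfx_regimes mult_1)
qed

lemma regret_le: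
  assumes k: "2 * k < n" and m: "2 * m \<le> n - 2 * k"
    and D: "is_sdude Ch H \<Lambda> k m n D" and switches: "AE \<omega> in A. nswitch (map \<omega> [0..<n]) \<le> m"
  shows "exp_loss Ch \<Lambda> P n D - DD Ch \<Lambda> P n \<le> excess_risk k
    + 2 * Lambda_max \<Lambda> * (real (k + 1) * real (m + 1) / real (n - 2 * k)) + deviation_bound k m n"
proof -
  let ?X = "2 * Lambda_max \<Lambda> * (real (k + 1) * real (m + 1))
    + real (n - 2 * k) * deviation_bound k m n"
  have "exp_loss Ch \<Lambda> P n D - DD Ch \<Lambda> P n \<le> (1 / real n) * (real n * excess_risk k + ?X)"
    using exp_loss_sdude_le[OF assms] regime_risk_le_DD[of n] by (simp only: add.assoc)
  also have "\<dots> = excess_risk k + ?X / real n"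
    using k by (simp add: field_simps)
  also have "?X / real n \<le> ?X / real (n - 2 * k)"
    using k m by (intro divide_left_mono add_nonneg_nonneg mult_nonneg_nonneg Lambda_max_nonneg)
      (auto intro!: mult_nonneg_nonneg schedule_rate_nonneg)
  also have "?X / real (n - 2 * k)
    = 2 * Lambda_max \<Lambda> * (real (k + 1) * real (m + 1) / real (n - 2 * k))
    + deviation_bound k m n"
    using k by (simp add: add_divide_distrib)
  finally show ?thesis by simp
qed

end

subsection \<open>Vanishing regret\<close>

lemma summable_imp_rate_tendsto_0:
  fixes k r :: "nat \<Rightarrow> nat" and b :: "nat \<Rightarrow> real"
  assumes r: "\<And>n. n \<ge> 1 \<Longrightarrow> 0 < r n" and b: "\<And>n. n \<ge> 1 \<Longrightarrow> 0 \<le> b n"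
    and summable: "\<And>\<epsilon>. 0 < \<epsilon> \<Longrightarrow> summable (\<lambda>n. 2 * real (k n + 1) *
      exp (- real (r n) * (\<epsilon>\<^sup>2 / (2 * real (k n + 1) * L\<^sup>2) - 2 * b n)))"
  shows "(\<lambda>n. real (k n + 1) * b n) \<longlonglongrightarrow> 0"
proof (rule tendstoI)
  fix \<delta> :: real assume \<delta>: "0 < \<delta>"
  define \<epsilon> where "\<epsilon> = (if L = 0 then 1 else 2 * sqrt \<delta> * \<bar>L\<bar>)"
  have \<epsilon>: "0 < \<epsilon>" using \<delta> by (simp add: \<epsilon>_def)
  have "\<epsilon>\<^sup>2 / L\<^sup>2 \<le> 4 * \<delta>" using \<delta> by (simp add: \<epsilon>_def power_mult_distrib)
  have "eventually (\<lambda>n. 2 * real (k n + 1) *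
      exp (- real (r n) * (\<epsilon>\<^sup>2 / (2 * real (k n + 1) * L\<^sup>2) - 2 * b n)) < 2) sequentially"
    by (rule order_tendstoD(2)[OF summable_LIMSEQ_zero[OF summable[OF \<epsilon>]]]) simp
  then show "eventually (\<lambda>n. dist (real (k n + 1) * b n) 0 < \<delta>) sequentially"
    using eventually_ge_at_top[of 1]
  proof eventually_elim
    case (elim n)
    let ?c = "real (k n + 1)"
    let ?x = "\<epsilon>\<^sup>2 / (2 * ?c * L\<^sup>2) - 2 * b n"
    have "1 * exp (- real (r n) * ?x) \<le> ?c * exp (- real (r n) * ?x)"
      by (intro mult_right_mono) simp_all
    then have "exp (- real (r n) * ?x) < 1" using elim(1) by linarith
    then have "0 < ?x" using r[OF elim(2)] by (simp add: zero_less_mult_iff)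
    then have "2 * ?c * (2 * b n) < 2 * ?c * (\<epsilon>\<^sup>2 / (2 * ?c * L\<^sup>2))"
      by (intro mult_strict_left_mono) simp_all
    also have "\<dots> = \<epsilon>\<^sup>2 / L\<^sup>2" by simp
    also note \<open>\<epsilon>\<^sup>2 / L\<^sup>2 \<le> 4 * \<delta>\<close>
    finally have "?c * b n < \<delta>" by linarith
    then show ?case using b[OF elim(2)] by simp
  qed
qed

lemma switch_rate_tendsto_0:
  fixes k m r C :: "nat \<Rightarrow> nat"
  assumes rate: "(\<lambda>n. real (k n + 1) * schedule_rate (C n) N (m n) (r n)) \<longlonglongrightarrow> 0" and N: "1 < N"
    and pos: "\<And>n. n \<ge> 1 \<Longrightarrow> 0 < C n \<and> 0 < r n \<and> m n \<le> r n"
  shows "(\<lambda>n. real (k n + 1) * real (m n + 1) / real (r n)) \<longlonglongrightarrow> 0"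
proof (rule tendsto_sandwich[where f = "\<lambda>_. 0"])
  let ?upper = "\<lambda>n. real (k n + 1) * schedule_rate (C n) N (m n) (r n) / ln (real N)"
  have ln_N: "0 < ln (real N)" using N by simp
  show "eventually (\<lambda>n. real (k n + 1) * real (m n + 1) / real (r n)
      \<le> ?upper n) sequentially"
    using eventually_ge_at_top[of 1]
  proof eventually_elim
    case (elim n)
    have "real (k n + 1) * (real (m n + 1) * ln (real N) / real (r n))
      \<le> real (k n + 1) * schedule_rate (C n) N (m n) (r n)"
      using pos[OF elim] N by (intro mult_left_mono schedule_rate_ge) simp_all
    then show ?case using ln_N by (simp add: pos_le_divide_eq)
  qed
  show "?upper \<longlonglongrightarrow> 0"
    using tendsto_divide[OF rate tendsto_const[of "ln (real N)"]] ln_N by simp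
qed simp_all

lemma DD_eq_exp_loss_if_card_1:
  fixes \<Lambda> :: "'x::finite \<Rightarrow> 'xh::finite \<Rightarrow> real" and Ch :: "'x \<Rightarrow> 'z::finite \<Rightarrow> real"
  assumes "CARD('xh) = 1"
  shows "DD Ch \<Lambda> P n = exp_loss Ch \<Lambda> P n D"
proof -
  have "x = y" for x y :: 'xh using assms by (metis UNIV_I card_1_singletonE singletonD)
  then have "D' = D" for D' :: "'z list \<Rightarrow> nat \<Rightarrow> 'xh" by (intro ext)
  then have "exp_loss Ch \<Lambda> P n D' = exp_loss Ch \<Lambda> P n D" for D' by (rule arg_cong)
  then have "range (exp_loss Ch \<Lambda> P n) = {exp_loss Ch \<Lambda> P n D}" by blast
  then show ?thesis by (simp add: DD_def)
qed

lemma one_less_card_fun: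
  assumes "CARD('b::finite) \<noteq> 1"
  shows "1 < CARD('a::finite \<Rightarrow> 'b)"
proof -
  have "1 < CARD('b)" using assms zero_less_card_finite[where 'a = 'b] by linarith
  also have "\<dots> = CARD('b) ^ 1" by simp
  also have "\<dots> \<le> CARD('b) ^ CARD('a)"
    by (intro power_increasing) (simp_all add: Suc_le_eq)
  finally show ?thesis by (simp add: card_fun)
qed

lemma (in denoising_switching_source) regret_tendsto_0:
  fixes k m :: "nat \<Rightarrow> nat" and D :: "nat \<Rightarrow> 'z list \<Rightarrow> nat \<Rightarrow> 'xh"
  assumes k: "\<And>n. n \<ge> 1 \<Longrightarrow> 2 * k n < n" and m: "\<And>n. n \<ge> 1 \<Longrightarrow> 2 * m n \<le> n - 2 * k n"
    and k_lim: "filterlim k at_top sequentially"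
    and rate: "(\<lambda>n. real (k n + 1) * sdude_rate TYPE('z \<Rightarrow> 'xh) (k n) (m n) n) \<longlonglongrightarrow> 0"
    and two_symbols: "CARD('xh) \<noteq> 1"
    and D: "\<And>n. n \<ge> 1 \<Longrightarrow> is_sdude Ch H \<Lambda> (k n) (m n) n (D n)"
    and switches: "\<And>n. AE \<omega> in A. nswitch (map \<omega> [0..<n]) \<le> m n"
  shows "(\<lambda>n. exp_loss Ch \<Lambda> P n (D n) - DD Ch \<Lambda> P n) \<longlonglongrightarrow> 0"
proof -
  let ?r = "\<lambda>n. n - 2 * k n"
  let ?bound = "\<lambda>n. excess_risk (k n)
    + 2 * Lambda_max \<Lambda> * (real (k n + 1) * real (m n + 1) / real (?r n))
    + deviation_bound (k n) (m n) n"
  have regret: "eventually (\<lambda>n. exp_loss Ch \<Lambda> P n (D n) - DD Ch \<Lambda> P n \<le> ?bound n) sequentially"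
    using eventually_ge_at_top[of 1] by (rule eventually_mono) (intro regret_le k m D switches)
  have switch_rate: "(\<lambda>n. real (k n + 1) * real (m n + 1) / real (?r n)) \<longlonglongrightarrow> 0"
    by (rule switch_rate_tendsto_0[OF rate one_less_card_fun[OF two_symbols]]) (use k m in force)
  have "?bound \<longlonglongrightarrow> 0 + 2 * Lambda_max \<Lambda> * 0 + sqrt (0 * (L_max Ch H \<Lambda>)\<^sup>2 / 2)"
    by (intro tendsto_add tendsto_mult tendsto_divide tendsto_real_sqrt tendsto_const rate
        switch_rate filterlim_compose[OF excess_risk_tendsto_0 k_lim]) simp
  then have bound: "?bound \<longlonglongrightarrow> 0" by simp
  show ?thesis
    by (rule tendsto_sandwich[OF _ regret tendsto_const bound]) (simp add: DD_le_exp_loss)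
qed

lemma classP_obtains_switching_source:
  fixes P :: "(nat \<Rightarrow> 'x::finite) measure"
  assumes "classP m P"
  obtains A N Q where "switching_source P A N Q" "\<And>n. AE \<omega> in A. nswitch (map \<omega> [0..<n]) \<le> m n"
  using assms unfolding classP_def switching_source_def by blast

theorem theorem6:
  fixes Ch :: "'x::finite \<Rightarrow> 'z::finite \<Rightarrow> real"
    and H :: "'z \<Rightarrow> 'x \<Rightarrow> real"
    and \<Lambda> :: "'x \<Rightarrow> 'xh::finite \<Rightarrow> real"
    and k m :: "nat \<Rightarrow> nat"
    and D :: "nat \<Rightarrow> 'z list \<Rightarrow> nat \<Rightarrow> 'xh"
    and P :: "(nat \<Rightarrow> 'x) measure"
  assumes "stochastic Ch" and "full_row_rank Ch" and "right_inverse Ch H"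
    and "\<forall>x y. \<Lambda> x y \<ge> 0"
    and "\<forall>n\<ge>1. 2 * k n < n"
    and "\<forall>n\<ge>1. m n \<le> (n - 2 * k n) div 2"
    and "filterlim k at_top sequentially"
    and "\<forall>\<epsilon>>0. summable (\<lambda>n. 2 * real (k n + 1) *
           exp (- real (n - 2 * k n) *
             (\<epsilon>\<^sup>2 / (2 * real (k n + 1) * (L_max Ch H \<Lambda>)\<^sup>2)
              - 2 * real CARD('z) ^ (2 * k n) *
                (hb (real (m n) / real (n - 2 * k n))
                 + real (m n + 1) * ln (real CARD('z \<Rightarrow> 'xh)) / real (n - 2 * k n)))))"
    and "\<forall>n\<ge>1. is_sdude Ch H \<Lambda> (k n) (m n) n (D n)"
    and "classP m P"
  shows "(\<lambda>n. exp_loss Ch \<Lambda> P n (D n) - DD Ch \<Lambda> P n) \<longlonglongrightarrow> 0"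
proof (cases "CARD('xh) = 1")
  case True
  \<comment> \<open>There is only one rule, and summability does not force \<open>(k + 1) (m + 1) / (n - 2k)\<close> to vanish.\<close>
  then have "DD Ch \<Lambda> P n = exp_loss Ch \<Lambda> P n (D n)" for n by (rule DD_eq_exp_loss_if_card_1)
  then show ?thesis by simp
next
  case False
  obtain A N Q where source: "switching_source P A N Q"
    and switches: "\<And>n. AE \<omega> in A. nswitch (map \<omega> [0..<n]) \<le> m n"
    using classP_obtains_switching_source[OF assms(10)] by blast
  interpret denoising_switching_source Ch \<Lambda> H P A N Q
    using source assms(1,3,4) by (intro_locales) (unfold_locales; simp)+
  have k: "2 * k n < n" and m: "2 * m n \<le> n - 2 * k n" if "n \<ge> 1" for n
    using assms(5,6) that by (auto simp: less_eq_div_iff_mult_less_eq)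
  have "(\<lambda>n. real (k n + 1) * sdude_rate TYPE('z \<Rightarrow> 'xh) (k n) (m n) n) \<longlonglongrightarrow> 0"
  proof (rule summable_imp_rate_tendsto_0[where r = "\<lambda>n. n - 2 * k n" and L = "L_max Ch H \<Lambda>"])
    show "0 \<le> sdude_rate TYPE('z \<Rightarrow> 'xh) (k n) (m n) n" if "n \<ge> 1" for n
      using k[OF that] m[OF that] by (intro schedule_rate_nonneg) auto
  qed (use k assms(8) in \<open>simp_all add: schedule_rate_def mult.assoc\<close>)
  then show ?thesis
    using regret_tendsto_0 k m assms(7) False assms(9) switches by blast
qed

end
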